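(* Let $q$ be a prime power and for $n\geq 1$ let $a_n$ be the number of separable $n \times n$ matrices over $\mathbf{F}_q$. Then $$1 + \sum_{n \geq 1} \frac{a_n}{\gamma_n} u^n = \prod_{d \geq 1} \left( 1 + \frac{u^d}{q^d-1} \right)^{\nu_d}$$ and $$1 + \sum_{n \geq 1} \frac{a_n}{\gamma_n} u^n = \frac{1}{1-u} \prod_{d \geq 1} \left( 1 + \frac{u^d(1-u^d)}{q^d(q^d-1)} \right)^{\nu_d}.$$
   Context: $\mathbf{F}_q$ is the field with $q$ elements. $\gamma_n=|\mathrm{GL}_n(q)|=(q^n-1)(q^n-q)\cdots(q^n-q^{n-1})$ is the order of the group of invertible $n\times n$ matrices over $\mathbf{F}_q$. $\nu_d$ is the number of monic irreducible polynomials of degree $d$ over $\mathbf{F}_q$. An $n\times n$ matrix $A$ over $\mathbf{F}_q$ is cyclic if there is a vector $v\in\mathbf{F}_q^n$ such that $\{A^iv : i=0,1,2,\ldots\}$ spans $\mathbf{F}_q^n$; it is semi-simple if it is diagonalizable over the algebraic closure of $\mathbf{F}_q$; it is separable if it is both cyclic and semi-simple (equivalently, its characteristic polynomial is square-free). The identities are of formal power series in $u$. *)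

theory Defs
  imports
    "HOL-Analysis.Infinite_Products"
    "HOL-Computational_Algebra.Formal_Power_Series"
    "HOL-Algebra.Algebraic_Closure_Type"
    "Jordan_Normal_Form.VS_Connect"
begin

text \<open>
  Any type of class \<^class>\<open>finite\<close> and \<^class>\<open>field\<close> serves as the field with
  $q = $ \<open>CARD('a)\<close> elements.
\<close>

definition cyclic_mat :: "'a :: field mat \<Rightarrow> bool" where
  "cyclic_mat A \<longleftrightarrow> square_mat A \<and>
     (\<exists>v \<in> carrier_vec (dim_row A).
        LinearCombinations.module.span class_ring (module_vec TYPE('a) (dim_row A))
          (range (\<lambda>i :: nat. (A ^\<^sub>m i) *\<^sub>v v)) = carrier_vec (dim_row A))"

definition diagonalizable_mat :: "'a :: field mat \<Rightarrow> bool" where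
  "diagonalizable_mat A \<longleftrightarrow> (\<exists>D. diagonal_mat D \<and> similar_mat A D)"

definition semisimple_mat :: "'a :: field mat \<Rightarrow> bool" where
  "semisimple_mat A \<longleftrightarrow> diagonalizable_mat (map_mat to_ac A)"

definition separable_mat :: "'a :: field mat \<Rightarrow> bool" where
  "separable_mat A \<longleftrightarrow> cyclic_mat A \<and> semisimple_mat A"

definition num_separable :: "'a :: {field, finite} itself \<Rightarrow> nat \<Rightarrow> nat" where
  "num_separable _ n = card {A :: 'a mat. A \<in> carrier_mat n n \<and> separable_mat A}"

definition GL_order :: "'a :: {field, finite} itself \<Rightarrow> nat \<Rightarrow> nat" where
  "GL_order _ n = card {A :: 'a mat. A \<in> carrier_mat n n \<and> invertible_mat A}"

definition num_monic_irreducible :: "'a :: {field, finite} itself \<Rightarrow> nat \<Rightarrow> nat" where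
  "num_monic_irreducible _ d =
     card {p :: 'a poly. lead_coeff p = 1 \<and> Factorial_Ring.irreducible p \<and> degree p = d}"

text \<open>
  Infinite products of formal power series are those of the library's \<^const>\<open>prodinf\<close>,
  taken in the $u$-adic topology on \<^typ>\<open>rat fps\<close>.  They are indexed from \<open>0\<close>, so the
  product over $d \geq 1$ runs over \<open>Suc d\<close>; as \<^const>\<open>prodinf\<close> is total, convergence has
  to be asserted separately.
\<close>

end

theory Submission
  imports Defs "Jordan_Normal_Form.Char_Poly"
begin

text \<open>
  A cyclic vector \<open>v\<close> of an $n \times n$ matrix \<open>A\<close> identifies $\mathbf{F}_q^n$ with
  $\mathbf{F}_q[x]/(f)$, where \<open>f\<close> is the monic annihilator of \<open>v\<close>, of degree \<open>n\<close>. The pairs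
  \<open>(A, v)\<close> with a given \<open>f\<close> are counted in two ways. Such a pair is determined by the invertible
  matrix with columns $v, Av, \ldots, A^{n-1}v$, and every invertible matrix occurs, so there are
  $\gamma_n$ pairs (\<open>card_cyclic_pairs\<close>). On the other hand the cyclic vectors of a fixed \<open>A\<close>
  correspond to the units of $\mathbf{F}_q[x]/(f)$ (\<open>card_cyclic_vecs\<close>). If $\varphi(f)$ denotes the
  number of these units, there are $\gamma_n/\varphi(f)$ cyclic matrices with annihilator \<open>f\<close>.

  A cyclic matrix is semi-simple exactly when \<open>f\<close> is squarefree. A repeated factor produces a
  polynomial in \<open>A\<close> that is nilpotent but not zero, which cannot be diagonalised
  (\<open>semisimple_cyclic_imp_squarefree\<close>). Conversely a squarefree polynomial over a finite field divides
  some $x^Q - x$ with $Q = 0$ in the field, so it has distinct roots in the algebraic closure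
  (\<open>card_roots_squarefree\<close>), and the Vandermonde matrix of these roots diagonalises the companion
  matrix of \<open>f\<close> (\<open>diagonalizable_companion\<close>).

  For squarefree \<open>f\<close> the number $\varphi(f)$ is the product of $q^{\deg p} - 1$ over the irreducible
  factors \<open>p\<close> (\<open>poly_totient_prod\<close>). Therefore $a_n/\gamma_n$ is the sum, over the finite sets of
  monic irreducibles of total degree \<open>n\<close>, of the products of $1/(q^{\deg p}-1)$, and this is the
  coefficient of $u^n$ in the first product.

  The factors of the second product are those of the first times $1 - u^d/q^d$, so it remains to
  see that $\prod_d (1 - u^d/q^d)^{\nu_d} = 1 - u$. Give each monic polynomial the weight
  $(u/q)^{\deg}$; the total weight is $1/(1-u)$. Discarding the multiples of an irreducible \<open>p\<close>
  multiplies the weight by $1 - (u/q)^{\deg p}$, and once the irreducibles of degree at most \<open>N\<close>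
  have been used only the polynomial \<open>1\<close> is left up to degree \<open>N\<close> (\<open>coprime_series_eq_prod\<close>,
  \<open>nth_coprime_series_irreducibles_upto\<close>).
\<close>


section \<open>Residues and their units modulo a polynomial over a finite field\<close>

text \<open>
  Stated through coefficients so that the zero polynomial belongs to the set for \<open>n = 0\<close> as well,
  where a bound on the degree would exclude it.
\<close>

definition polys_below :: "nat \<Rightarrow> 'a :: zero poly set" where
  "polys_below n = {g. \<forall>i\<ge>n. Polynomial.coeff g i = 0}"

lemma polys_below_iff: "g \<in> polys_below n \<longleftrightarrow> g = 0 \<or> Polynomial.degree g < n"
proof
  assume *: "g \<in> polys_below n"
  show "g = 0 \<or> Polynomial.degree g < n"
  proof (rule ccontr)
    assume "\<not> ?thesis"
    then have "g \<noteq> 0" "n \<le> Polynomial.degree g" by simp_all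
    with * have "Polynomial.lead_coeff g = 0" unfolding polys_below_def by blast
    with \<open>g \<noteq> 0\<close> show False by simp
  qed
next
  assume "g = 0 \<or> Polynomial.degree g < n"
  then show "g \<in> polys_below n" by (auto simp: polys_below_def coeff_eq_0)
qed

lemma pCons_in_polys_below: "pCons c h \<in> polys_below (Suc n) \<longleftrightarrow> h \<in> polys_below n"
  by (simp add: polys_below_iff)

lemma polys_below_Suc: "polys_below (Suc n) = (\<lambda>(c, g). pCons c g) ` (UNIV \<times> polys_below n)"
proof (intro equalityI subsetI)
  fix g :: "'a poly" assume g: "g \<in> polys_below (Suc n)"
  obtain c h where gh: "g = pCons c h" by (rule pCons_cases)
  with g have "h \<in> polys_below n" by (simp only: pCons_in_polys_below)
  with gh show "g \<in> (\<lambda>(c, g). pCons c g) ` (UNIV \<times> polys_below n)"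
    by (intro image_eqI[of _ _ "(c, h)"]) simp_all
next
  fix g :: "'a poly" assume "g \<in> (\<lambda>(c, g). pCons c g) ` (UNIV \<times> polys_below n)"
  then obtain c h where "h \<in> polys_below n" "g = pCons c h" by auto
  then show "g \<in> polys_below (Suc n)" by (simp only: pCons_in_polys_below)
qed

lemma polys_below_0: "polys_below 0 = {0}"
  by (auto simp: polys_below_iff)

lemma finite_polys_below [simp]: "finite (polys_below n :: 'a :: {zero, finite} poly set)"
  by (induction n) (simp_all add: polys_below_0 polys_below_Suc)

lemma card_polys_below: "card (polys_below n :: 'a :: {zero, finite} poly set) = CARD('a) ^ n"
proof (induction n)
  case (Suc n)
  have "inj_on (\<lambda>(c, g). pCons c g) (UNIV \<times> polys_below n :: ('a \<times> 'a poly) set)"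
    by (auto simp: inj_on_def)
  with Suc show ?case
    by (simp add: polys_below_Suc card_image card_cartesian_product)
qed (simp add: polys_below_0)

lemma diff_in_polys_below:
  fixes g h :: "'a :: ab_group_add poly"
  shows "g \<in> polys_below n \<Longrightarrow> h \<in> polys_below n \<Longrightarrow> g - h \<in> polys_below n"
  by (auto simp: polys_below_def)

lemma mod_in_polys_below:
  fixes f :: "'a :: field poly"
  shows "f \<noteq> 0 \<Longrightarrow> g mod f \<in> polys_below (Polynomial.degree f)"
  by (metis degree_mod_less polys_below_iff)

lemma polys_below_dvd_imp_0:
  fixes f :: "'a :: field poly"
  assumes "g \<in> polys_below (Polynomial.degree f)" and "f dvd g"
  shows "g = 0"
  using assms by (metis dvd_imp_degree_le linorder_not_less polys_below_iff)

text \<open>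
  Together with \<open>mod_in_polys_below\<close> this makes the polynomials of degree below that of \<open>f\<close> a system
  of representatives of the residue classes modulo \<open>f\<close>.
\<close>

lemma polys_below_cong_imp_eq:
  fixes f :: "'a :: field poly"
  assumes "g \<in> polys_below (Polynomial.degree f)" "h \<in> polys_below (Polynomial.degree f)"
    and "f dvd g - h"
  shows "g = h"
  using polys_below_dvd_imp_0[OF diff_in_polys_below[OF assms(1,2)] assms(3)] by simp

text \<open>
  Invertibility in the quotient ring modulo \<open>f\<close>. An explicit inverse is used in place of coprimality
  because the inverse is what recovers one cyclic vector of a matrix from another.
\<close>

definition unit_mod :: "'a :: field poly \<Rightarrow> 'a poly \<Rightarrow> bool" where
  "unit_mod f g \<longleftrightarrow> (\<exists>h. f dvd h * g - 1)"

text \<open>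
  The analogue of Euler's totient function: the order of the unit group of the quotient ring.
\<close>

definition poly_totient :: "'a :: field poly \<Rightarrow> nat" where
  "poly_totient f = card {g \<in> polys_below (Polynomial.degree f). unit_mod f g}"

lemma unit_mod_cong:
  assumes "f dvd g - g'"
  shows "unit_mod f g \<longleftrightarrow> unit_mod f g'"
proof -
  have "f dvd h * g - 1 \<longleftrightarrow> f dvd h * g' - 1" for h
  proof -
    have "h * g - 1 = h * (g - g') + (h * g' - 1)" by (simp add: algebra_simps)
    then show ?thesis by (metis assms dvd_add_right_iff dvd_mult)
  qed
  then show ?thesis by (simp add: unit_mod_def)
qed

lemma unit_mod_mod: "unit_mod f (g mod f) \<longleftrightarrow> unit_mod f g"
  by (rule unit_mod_cong) (metis dvd_minus_mod dvd_minus_iff minus_diff_eq)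

text \<open>
  Inverses \<open>a\<close> and \<open>b\<close> of \<open>g\<close> modulo the two factors combine to the inverse \<open>a + b - a * b * g\<close>
  modulo the product, because \<open>(a * g - 1) * (b * g - 1) = 1 - (a + b - a * b * g) * g\<close>.
\<close>

lemma unit_mod_mult:
  "unit_mod (f1 * f2) g \<longleftrightarrow> unit_mod f1 g \<and> unit_mod f2 g"
proof
  assume "unit_mod (f1 * f2) g"
  then show "unit_mod f1 g \<and> unit_mod f2 g"
    unfolding unit_mod_def by (meson dvd_mult_left dvd_mult_right)
next
  assume "unit_mod f1 g \<and> unit_mod f2 g"
  then obtain a b where "f1 dvd a * g - 1" "f2 dvd b * g - 1" unfolding unit_mod_def by blast
  then have "f1 * f2 dvd - ((a * g - 1) * (b * g - 1))" by (simp only: dvd_minus_iff mult_dvd_mono)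
  also have "\<dots> = (a + b - a * b * g) * g - 1" by (simp add: algebra_simps)
  finally show "unit_mod (f1 * f2) g" unfolding unit_mod_def by blast
qed

lemma poly_totient_1 [simp]: "poly_totient (1 :: 'a :: field poly) = 1"
proof -
  have "{g \<in> polys_below (Polynomial.degree (1 :: 'a poly)). unit_mod (1 :: 'a poly) g} = {0}"
    by (auto simp: polys_below_0 unit_mod_def)
  then show ?thesis unfolding poly_totient_def by simp
qed

text \<open>
  The quotient by an irreducible polynomial is a finite integral domain, hence a field, so every
  nonzero residue is a unit.
\<close>

lemma poly_totient_irreducible:
  fixes p :: "'a :: {field, finite} poly"
  assumes "Factorial_Ring.irreducible p"
  shows "poly_totient p = CARD('a) ^ Polynomial.degree p - 1"
proof -
  let ?B = "polys_below (Polynomial.degree p) :: 'a poly set"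
  have prime: "prime_elem p" using assms by (rule field_poly_irreducible_imp_prime)
  then have p0: "p \<noteq> 0" by auto
  have pd: "Polynomial.degree p > 0"
    using irreducible_not_unit[OF assms] p0 by (simp add: is_unit_iff_degree)
  have unit: "unit_mod p g" if g: "g \<in> ?B" "g \<noteq> 0" for g
  proof -
    have ndvd: "\<not> p dvd g" using polys_below_dvd_imp_0 g by blast
    \<comment> \<open>Multiplication by \<open>g\<close> permutes the finitely many residues, so it attains the residue \<open>1\<close>.\<close>
    let ?m = "\<lambda>h. (h * g) mod p"
    have "inj_on ?m ?B"
    proof (rule inj_onI)
      fix h h' assume hh: "h \<in> ?B" "h' \<in> ?B" and "?m h = ?m h'"
      then have "p dvd h * g - h' * g" by (simp add: mod_eq_dvd_iff)
      then have "p dvd (h - h') * g" by (simp add: algebra_simps)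
      then have "p dvd h - h'" using prime ndvd by (simp add: prime_elem_dvd_mult_iff)
      then show "h = h'" using hh polys_below_cong_imp_eq by blast
    qed
    moreover have "?m ` ?B \<subseteq> ?B" using mod_in_polys_below[OF p0] by auto
    ultimately have "?m ` ?B = ?B" by (simp add: endo_inj_surj)
    moreover have "1 \<in> ?B" using pd by (simp add: polys_below_iff)
    ultimately obtain h where "1 = (h * g) mod p" by (metis (mono_tags, lifting) imageE)
    then have "p dvd h * g - 1" by (metis dvd_minus_mod)
    then show ?thesis by (auto simp: unit_mod_def)
  qed
  have "\<not> p dvd 1" using prime by (rule prime_elem_not_unit)
  then have "\<not> unit_mod p 0" unfolding unit_mod_def by simp
  with unit have "{g \<in> ?B. unit_mod p g} = ?B - {0}" by auto
  then show ?thesis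
    using pd by (simp add: poly_totient_def card_polys_below card_Diff_subset polys_below_iff)
qed

text \<open>
  The Chinese remainder theorem, obtained by counting: the pair of remainders modulo \<open>p\<close> and \<open>h\<close>
  determines the residue modulo \<open>p * h\<close> because \<open>p\<close> is prime and does not divide \<open>h\<close>, and since
  source and target have the same cardinality every pair of remainders occurs.
\<close>

lemma poly_totient_mult:
  fixes p h :: "'a :: {field, finite} poly"
  assumes "Factorial_Ring.irreducible p" and "\<not> p dvd h" and "h \<noteq> 0"
  shows "poly_totient (p * h) = poly_totient p * poly_totient h"
proof -
  have prime: "prime_elem p" using assms(1) by (rule field_poly_irreducible_imp_prime)
  then have p0: "p \<noteq> 0" by auto
  let ?B = "polys_below (Polynomial.degree (p * h)) :: 'a poly set"
  let ?C = "polys_below (Polynomial.degree p) \<times> polys_below (Polynomial.degree h) ::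
    ('a poly \<times> 'a poly) set"
  let ?U = "{g \<in> ?B. unit_mod (p * h) g}"
  let ?V = "{g \<in> polys_below (Polynomial.degree p). unit_mod p g} \<times>
            {g \<in> polys_below (Polynomial.degree h). unit_mod h g}"
  let ?r = "\<lambda>g. (g mod p, g mod h)"
  have inj: "inj_on ?r ?B"
  proof (rule inj_onI)
    fix g g' assume g: "g \<in> ?B" "g' \<in> ?B" and "?r g = ?r g'"
    then have "p dvd g - g'" "h dvd g - g'" by (auto simp: mod_eq_dvd_iff)
    then obtain e where e: "g - g' = h * e" by blast
    with \<open>p dvd g - g'\<close> prime assms(2) have "p dvd e" by (simp add: prime_elem_dvd_mult_iff)
    then have "p * h dvd g - g'" using e by (simp add: mult.commute mult_dvd_mono)
    then show "g = g'" using polys_below_cong_imp_eq g by blast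
  qed
  have sub: "?r ` ?B \<subseteq> ?C" using mod_in_polys_below p0 assms(3) by auto
  have "card ?C = card ?B"
    using p0 assms(3) by (simp add: card_cartesian_product card_polys_below degree_mult_eq power_add)
  then have "?r ` ?B = ?C"
    using inj sub by (intro card_subset_eq) (simp_all add: card_image)
  moreover have "g \<in> ?U \<longleftrightarrow> g \<in> ?B \<and> ?r g \<in> ?V" for g
    using mod_in_polys_below[OF p0, of g] mod_in_polys_below[OF assms(3), of g]
    by (auto simp: unit_mod_mod unit_mod_mult)
  moreover have "?V \<subseteq> ?C" by auto
  ultimately have image: "?r ` ?U = ?V"
  proof -
    assume C: "?r ` ?B = ?C" and U: "\<And>g. g \<in> ?U \<longleftrightarrow> g \<in> ?B \<and> ?r g \<in> ?V" and V: "?V \<subseteq> ?C"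
    show ?thesis
    proof (intro equalityI subsetI)
      fix x assume "x \<in> ?V"
      then have "x \<in> ?r ` ?B" unfolding C by (rule subsetD[OF V])
      then obtain g where g: "g \<in> ?B" "x = ?r g" by (rule imageE)
      from g \<open>x \<in> ?V\<close> have "g \<in> ?U" by (simp only: U)
      with g(2) show "x \<in> ?r ` ?U" by (rule image_eqI)
    next
      fix x assume "x \<in> ?r ` ?U"
      then obtain g where "g \<in> ?U" "x = ?r g" by (rule imageE)
      then show "x \<in> ?V" by (simp only: U)
    qed
  qed
  have "inj_on ?r ?U" using inj by (rule inj_on_subset) auto
  then have "card ?U = card ?V" using card_image image by fastforce
  then show ?thesis by (simp add: poly_totient_def card_cartesian_product)
qed

section \<open>Squarefree polynomials as sets of monic irreducibles\<close>

definition monic_irreducibles :: "'a :: field poly set" where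
  "monic_irreducibles = {p. Polynomial.lead_coeff p = 1 \<and> Factorial_Ring.irreducible p}"

lemma monic_irreducibles_D:
  assumes "p \<in> monic_irreducibles"
  shows "prime_elem p" "p \<noteq> 0" "Polynomial.degree p > 0" "Polynomial.lead_coeff p = 1"
    "Factorial_Ring.irreducible p"
proof -
  show "Polynomial.lead_coeff p = 1" and irr: "Factorial_Ring.irreducible p"
    using assms by (auto simp: monic_irreducibles_def)
  from irr show "prime_elem p" by (rule field_poly_irreducible_imp_prime)
  then show "p \<noteq> 0" by auto
  then show "Polynomial.degree p > 0"
    using irreducible_not_unit[OF irr] by (simp add: is_unit_iff_degree)
qed

lemma monic_irreducible_dvd_imp_eq:
  assumes "p \<in> monic_irreducibles" "p' \<in> monic_irreducibles" "p dvd p'"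
  shows "p = p'"
proof -
  obtain c where c: "p' = p * c" using assms(3) by blast
  have "is_unit c"
    using Factorial_Ring.irreducibleD[OF monic_irreducibles_D(5)[OF assms(2)] c]
      irreducible_not_unit[OF monic_irreducibles_D(5)[OF assms(1)]] by blast
  then obtain a where a: "c = [:a:]" unfolding is_unit_poly_iff by blast
  with c have "Polynomial.lead_coeff p' = Polynomial.lead_coeff p * a"
    by (simp add: lead_coeff_mult)
  with assms have "a = 1" by (simp add: monic_irreducibles_def)
  with c a show ?thesis by (simp add: one_pCons)
qed

text \<open>
  A nonconstant divisor of least degree admits no proper factorisation.
\<close>

lemma monic_irreducible_factor_exists:
  fixes f :: "'a :: field poly"
  assumes "Polynomial.degree f > 0"
  shows "\<exists>p \<in> monic_irreducibles. p dvd f"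
proof -
  define P where "P d \<longleftrightarrow> (\<exists>p. p dvd f \<and> Polynomial.degree p = d \<and> d > 0)" for d
  define d where "d = (LEAST d. P d)"
  have "P (Polynomial.degree f)" unfolding P_def by (rule exI[of _ f]) (use assms in simp)
  then have "P d" unfolding d_def by (rule LeastI)
  then obtain p where p: "p dvd f" "Polynomial.degree p = d" "d > 0" by (auto simp: P_def)
  have least: "Polynomial.degree g \<ge> d" if "g dvd f" "Polynomial.degree g > 0" for g
    unfolding d_def by (rule Least_le) (use that in \<open>auto simp: P_def\<close>)
  have p0: "p \<noteq> 0" using p by auto
  define p' where "p' = Polynomial.smult (inverse (Polynomial.lead_coeff p)) p"
  have p': "p' dvd f" "Polynomial.degree p' = d" "Polynomial.lead_coeff p' = 1"
    using p p0 by (auto simp: p'_def smult_dvd_iff)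
  have "Factorial_Ring.irreducible p'"
  proof (rule Factorial_Ring.irreducibleI)
    show "p' \<noteq> 0" using p' p by auto
    show "\<not> is_unit p'" using p' p by (metis is_unit_iff_degree neq0_conv not_is_unit_0)
    fix a b assume ab: "p' = a * b"
    then have nz: "a \<noteq> 0" "b \<noteq> 0" using \<open>p' \<noteq> 0\<close> by auto
    have deg: "Polynomial.degree a + Polynomial.degree b = d"
      using p'(2) nz by (simp add: ab degree_mult_eq)
    show "is_unit a \<or> is_unit b"
    proof (cases "Polynomial.degree a = 0")
      case False
      have "a dvd f" using p'(1) ab by (metis dvd_mult_left)
      with least[of a] False deg have "Polynomial.degree b = 0" by simp
      then show ?thesis using nz by (simp add: is_unit_iff_degree)
    qed (use nz in \<open>simp add: is_unit_iff_degree\<close>)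
  qed
  with p' show ?thesis by (auto simp: monic_irreducibles_def)
qed

lemma lead_coeff_prod_monic:
  assumes "S \<subseteq> monic_irreducibles"
  shows "Polynomial.lead_coeff (\<Prod>S) = 1"
  using assms by (auto simp: lead_coeff_prod monic_irreducibles_def intro!: prod.neutral)

lemma monic_irreducible_dvd_prod_iff:
  assumes "S \<subseteq> monic_irreducibles" "finite S" "p \<in> monic_irreducibles"
  shows "p dvd \<Prod>S \<longleftrightarrow> p \<in> S"
proof
  assume "p dvd \<Prod>S"
  with assms(2) have "\<exists>p'\<in>S. p dvd p'"
    by (induction S rule: finite_induct)
       (use monic_irreducibles_D(1)[OF assms(3)] prime_elem_not_unit[of p] in
         \<open>auto simp: prime_elem_dvd_mult_iff\<close>)
  then obtain p' where "p' \<in> S" "p dvd p'" by blast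
  moreover from this have "p = p'"
    using assms monic_irreducible_dvd_imp_eq[OF assms(3), of p'] by blast
  ultimately show "p \<in> S" by simp
qed (use assms in \<open>auto intro: dvd_prodI\<close>)

lemma degree_prod_monic:
  assumes "S \<subseteq> monic_irreducibles"
  shows "Polynomial.degree (\<Prod>S) = (\<Sum>p\<in>S. Polynomial.degree p)"
  using degree_prod_eq_sum_degree[of S "\<lambda>p. p"] monic_irreducibles_D(2) assms by blast

lemma poly_totient_prod:
  fixes S :: "'a :: {field, finite} poly set"
  assumes "finite S" "S \<subseteq> monic_irreducibles"
  shows "poly_totient (\<Prod>S) = (\<Prod>p\<in>S. CARD('a) ^ Polynomial.degree p - 1)"
  using assms
proof (induction rule: finite_induct)
  case (insert p S)
  then have "\<not> p dvd \<Prod>S" "\<Prod>S \<noteq> 0"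
    using monic_irreducible_dvd_prod_iff[of S p] monic_irreducibles_D(2) by auto
  with insert show ?case
    by (simp add: poly_totient_mult monic_irreducibles_D(5) poly_totient_irreducible)
qed simp

definition monic_squarefree :: "nat \<Rightarrow> 'a :: field poly set" where
  "monic_squarefree n =
     {f. Polynomial.lead_coeff f = 1 \<and> squarefree f \<and> Polynomial.degree f = n}"

definition irreducible_sets :: "nat \<Rightarrow> 'a :: field poly set set" where
  "irreducible_sets n =
     {S. finite S \<and> S \<subseteq> monic_irreducibles \<and> (\<Sum>p\<in>S. Polynomial.degree p) = n}"

lemma squarefree_prod_monic_irreducibles:
  fixes S :: "'a :: field poly set"
  assumes "finite S" "S \<subseteq> monic_irreducibles"
  shows "squarefree (\<Prod>S)"
proof (rule squarefreeI, rule ccontr)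
  fix g :: "'a poly" assume g: "g\<^sup>2 dvd \<Prod>S" and "\<not> is_unit g"
  have nz: "\<Prod>S \<noteq> 0" using lead_coeff_prod_monic[OF assms(2)] by auto
  with g have "g \<noteq> 0" by auto
  with \<open>\<not> is_unit g\<close> have "Polynomial.degree g > 0" by (simp add: is_unit_iff_degree)
  then obtain p where p: "p \<in> monic_irreducibles" "p dvd g"
    using monic_irreducible_factor_exists by blast
  have "p\<^sup>2 dvd \<Prod>S" using p(2) g by (meson dvd_power_same dvd_trans)
  then have "p dvd \<Prod>S" by (metis dvd_mult_left power2_eq_square)
  then have "p \<in> S" using monic_irreducible_dvd_prod_iff assms p by blast
  then have "\<Prod>S = p * \<Prod>(S - {p})" using assms(1) by (simp add: prod.remove)
  with \<open>p\<^sup>2 dvd \<Prod>S\<close> have "p dvd \<Prod>(S - {p})"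
    using monic_irreducibles_D(2)[OF p(1)] by (simp add: power2_eq_square)
  then show False
    using monic_irreducible_dvd_prod_iff[of "S - {p}" p] assms p(1) by blast
qed

text \<open>
  Induction on the degree. After splitting off an irreducible factor \<open>p\<close> the cofactor is again
  squarefree, and \<open>p\<close> does not occur in it since \<open>p\<^sup>2\<close> does not divide \<open>f\<close>.
\<close>

lemma monic_squarefree_imp_prod:
  fixes f :: "'a :: field poly"
  assumes "Polynomial.lead_coeff f = 1" "squarefree f"
  shows "\<exists>S. finite S \<and> S \<subseteq> monic_irreducibles \<and> f = \<Prod>S"
  using assms
proof (induction "Polynomial.degree f" arbitrary: f rule: less_induct)
  case less
  show ?case
  proof (cases "Polynomial.degree f = 0")
    case True
    then obtain c where "f = [:c:]" by (rule degree_eq_zeroE)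
    with less.prems(1) have "f = 1" by (simp add: one_pCons)
    then show ?thesis by (intro exI[of _ "{}"]) auto
  next
    case False
    then obtain p h where p: "p \<in> monic_irreducibles" and f: "f = p * h"
      using monic_irreducible_factor_exists[of f] by blast
    have h: "h \<noteq> 0" "Polynomial.lead_coeff h = 1"
      using less.prems(1) monic_irreducibles_D(4)[OF p] by (auto simp: f lead_coeff_mult)
    have "squarefree h" using less.prems(2) f by (metis dvd_triv_right squarefree_mono)
    moreover have "Polynomial.degree h < Polynomial.degree f"
      using h monic_irreducibles_D(2,3)[OF p] by (simp add: f degree_mult_eq)
    ultimately obtain S where S: "finite S" "S \<subseteq> monic_irreducibles" "h = \<Prod>S"
      using less.hyps h by blast
    have "p \<notin> S"
    proof
      assume "p \<in> S"
      then have "p dvd h" using S by (auto intro: dvd_prodI)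
      then have "p\<^sup>2 dvd f" by (simp add: f power2_eq_square)
      then show False
        using less.prems(2) monic_irreducibles_D(1)[OF p] by (auto simp: squarefree_def prime_elem_def)
    qed
    then show ?thesis using S p f by (intro exI[of _ "insert p S"]) auto
  qed
qed

text \<open>
  Unique factorisation in the form in which it enters the generating function: a sum over squarefree
  polynomials becomes a sum over sets of irreducibles, which is how an expanded product is indexed.
\<close>

lemma bij_betw_irreducible_sets:
  "bij_betw Prod (irreducible_sets n) (monic_squarefree n :: 'a :: field poly set)"
proof (rule bij_betwI')
  fix S T :: "'a poly set"
  assume ST: "S \<in> irreducible_sets n" "T \<in> irreducible_sets n"
  show "(\<Prod>S = \<Prod>T) = (S = T)"
  proof
    assume eq: "\<Prod>S = \<Prod>T"
    have "p \<in> S \<longleftrightarrow> p \<in> T" if "p \<in> monic_irreducibles" for p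
      using ST that eq monic_irreducible_dvd_prod_iff[of S p] monic_irreducible_dvd_prod_iff[of T p]
      by (auto simp: irreducible_sets_def)
    with ST show "S = T" by (auto simp: irreducible_sets_def)
  qed simp
next
  fix S :: "'a poly set" assume "S \<in> irreducible_sets n"
  then show "\<Prod>S \<in> monic_squarefree n"
    using lead_coeff_prod_monic[of S] degree_prod_monic[of S]
    by (simp add: irreducible_sets_def monic_squarefree_def squarefree_prod_monic_irreducibles)
next
  fix f :: "'a poly" assume "f \<in> monic_squarefree n"
  then have f: "Polynomial.lead_coeff f = 1" "squarefree f" "Polynomial.degree f = n"
    unfolding monic_squarefree_def by blast+
  from monic_squarefree_imp_prod[OF f(1,2)]
  obtain S where S: "finite S" "S \<subseteq> monic_irreducibles" "f = \<Prod>S" by blast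
  then have "S \<in> irreducible_sets n"
    using f(3) degree_prod_monic[OF S(2)] by (simp add: irreducible_sets_def)
  with S(3) show "\<exists>S\<in>irreducible_sets n. f = \<Prod>S" by blast
qed


section \<open>Products over irreducible polynomials as power series\<close>

definition monic_irreducibles_upto :: "nat \<Rightarrow> 'a :: field poly set" where
  "monic_irreducibles_upto N = {p \<in> monic_irreducibles. Polynomial.degree p \<le> N}"

lemma finite_monic_irreducibles_upto [simp]:
  "finite (monic_irreducibles_upto N :: 'a :: {field, finite} poly set)"
  by (rule finite_subset[OF _ finite_polys_below[of "Suc N"]])
     (auto simp: monic_irreducibles_upto_def polys_below_iff)

text \<open>
  The exponent in degree \<open>d\<close> is the number of monic irreducibles of that degree, so a partial
  product over degrees is a product over irreducibles. This is where the exponents disappear.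
\<close>

lemma prod_powers_eq_prod_irreducibles:
  fixes h :: "nat \<Rightarrow> 'b :: comm_semiring_1"
  shows "(\<Prod>d\<le>N. h (Suc d) ^ num_monic_irreducible TYPE('a :: {field, finite}) (Suc d)) =
    (\<Prod>p \<in> (monic_irreducibles_upto (Suc N) :: 'a poly set). h (Polynomial.degree p))"
proof -
  let ?I = "monic_irreducibles_upto (Suc N) :: 'a poly set"
  have "(\<Prod>p\<in>?I. h (Polynomial.degree p)) =
      (\<Prod>d\<in>Suc ` {..N}. \<Prod>p\<in>{p \<in> ?I. Polynomial.degree p = d}. h (Polynomial.degree p))"
  proof (rule prod.group[symmetric])
    show "Polynomial.degree ` ?I \<subseteq> Suc ` {..N}"
    proof
      fix d assume "d \<in> Polynomial.degree ` ?I"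
      then have "0 < d" "d \<le> Suc N"
        using monic_irreducibles_D(3) by (auto simp: monic_irreducibles_upto_def)
      then show "d \<in> Suc ` {..N}" by (intro image_eqI[of _ _ "d - 1"]) auto
    qed
  qed simp_all
  also have "\<dots> = (\<Prod>d\<le>N. \<Prod>p\<in>{p \<in> ?I. Polynomial.degree p = Suc d}. h (Polynomial.degree p))"
    by (subst prod.reindex) simp_all
  also have "\<dots> = (\<Prod>d\<le>N. h (Suc d) ^ num_monic_irreducible TYPE('a) (Suc d))"
  proof (rule prod.cong[OF refl])
    fix d assume "d \<in> {..N}"
    then have "{p \<in> ?I. Polynomial.degree p = Suc d} =
        {p. Polynomial.lead_coeff p = 1 \<and> Factorial_Ring.irreducible p \<and> Polynomial.degree p = Suc d}"
      by (auto simp: monic_irreducibles_upto_def monic_irreducibles_def)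
    moreover have "(\<Prod>p\<in>{p \<in> ?I. Polynomial.degree p = Suc d}. h (Polynomial.degree p)) =
        (\<Prod>p\<in>{p \<in> ?I. Polynomial.degree p = Suc d}. h (Suc d))"
      by (rule prod.cong) auto
    ultimately show "(\<Prod>p\<in>{p \<in> ?I. Polynomial.degree p = Suc d}. h (Polynomial.degree p)) =
        h (Suc d) ^ num_monic_irreducible TYPE('a) (Suc d)"
      by (simp add: num_monic_irreducible_def)
  qed
  finally show ?thesis by simp
qed

text \<open>
  The sum of $u^{\deg f} / \varphi(f)$ over the monic squarefree polynomials $f$, where $\varphi$ is the
  totient above and $f$ is given by its set of irreducible factors. Both sides of each of the two
  identities are shown to be equal to it.
\<close>

definition squarefree_series :: "'a :: {field, finite} itself \<Rightarrow> rat fps" where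
  "squarefree_series _ = Abs_fps (\<lambda>n. \<Sum>S \<in> (irreducible_sets n :: 'a poly set set).
     \<Prod>p\<in>S. 1 / (of_nat CARD('a) ^ Polynomial.degree p - 1))"

lemma prod_fps_const_X_power:
  "finite S \<Longrightarrow> (\<Prod>p\<in>S. fps_const (c p :: 'b :: comm_ring_1) * fps_X ^ k p) =
     fps_const (\<Prod>p\<in>S. c p) * fps_X ^ (\<Sum>p\<in>S. k p)"
  by (induction S rule: finite_induct) (simp_all add: power_add mult_ac flip: fps_const_mult)

text \<open>
  Expanding the product selects a set of irreducibles, which contributes in the degree that is the sum
  of their degrees. A set contributing in degree \<open>n\<close> has no member of degree above \<open>n\<close>, so the
  coefficient no longer changes once the irreducibles up to degree \<open>n\<close> are included.
\<close>

lemma nth_prod_one_plus_irreducibles: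
  assumes "n \<le> N"
  shows "fps_nth (\<Prod>p \<in> (monic_irreducibles_upto N :: 'a :: {field, finite} poly set).
       1 + fps_const (1 / (of_nat CARD('a) ^ Polynomial.degree p - 1)) * fps_X ^ Polynomial.degree p) n =
    fps_nth (squarefree_series TYPE('a)) n"
proof -
  let ?I = "monic_irreducibles_upto N :: 'a poly set"
  let ?c = "\<lambda>p :: 'a poly. 1 / (of_nat CARD('a) ^ Polynomial.degree p - 1) :: rat"
  let ?deg = "\<lambda>S :: 'a poly set. \<Sum>p\<in>S. Polynomial.degree p"
  have fin: "finite ?I" by simp
  have "(\<Prod>p\<in>?I. 1 + fps_const (?c p) * fps_X ^ Polynomial.degree p) =
      (\<Prod>p\<in>?I. fps_const (?c p) * fps_X ^ Polynomial.degree p + 1)" by (simp add: add.commute)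
  also have "\<dots> = (\<Sum>S\<in>Pow ?I. \<Prod>p\<in>S. fps_const (?c p) * fps_X ^ Polynomial.degree p)"
    using prod_add[OF fin, of "\<lambda>p. fps_const (?c p) * fps_X ^ Polynomial.degree p" "\<lambda>_. 1"] by simp
  also have "\<dots> = (\<Sum>S\<in>Pow ?I. fps_const (\<Prod>p\<in>S. ?c p) * fps_X ^ ?deg S)"
    using fin by (intro sum.cong refl prod_fps_const_X_power) (auto intro: finite_subset)
  finally have "fps_nth (\<Prod>p\<in>?I. 1 + fps_const (?c p) * fps_X ^ Polynomial.degree p) n =
      (\<Sum>S\<in>Pow ?I. if n = ?deg S then \<Prod>p\<in>S. ?c p else 0)"
    by (simp add: fps_sum_nth fps_X_power_nth if_distrib cong: if_cong)
  also have "\<dots> = (\<Sum>S\<in>{S \<in> Pow ?I. n = ?deg S}. \<Prod>p\<in>S. ?c p)"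
    using fin by (subst sum.inter_filter) simp_all
  also have "{S \<in> Pow ?I. n = ?deg S} = irreducible_sets n"
  proof (intro equalityI subsetI)
    fix S assume "S \<in> {S \<in> Pow ?I. n = ?deg S}"
    then show "S \<in> irreducible_sets n"
      using finite_subset[OF _ fin] by (auto simp: irreducible_sets_def monic_irreducibles_upto_def)
  next
    fix S :: "'a poly set" assume S: "S \<in> irreducible_sets n"
    then have "Polynomial.degree p \<le> n" if "p \<in> S" for p
      using member_le_sum[OF that, of Polynomial.degree] by (auto simp: irreducible_sets_def)
    with S assms have "S \<subseteq> ?I"
      by (fastforce simp: irreducible_sets_def monic_irreducibles_upto_def)
    with S show "S \<in> {S \<in> Pow ?I. n = ?deg S}" by (auto simp: irreducible_sets_def)
  qed
  finally show ?thesis by (simp add: squarefree_series_def)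
qed

lemma nth_squarefree_series_0:
  "fps_nth (squarefree_series TYPE('a :: {field, finite})) 0 = 1"
proof -
  have "(monic_irreducibles_upto 0 :: 'a poly set) = {}"
    using monic_irreducibles_D(3) by (auto simp: monic_irreducibles_upto_def)
  then show ?thesis using nth_prod_one_plus_irreducibles[of 0 0, where ?'a = 'a] by simp
qed

text \<open>
  What remains of the monic polynomials of degree \<open>n\<close> after sieving by the irreducibles in \<open>S\<close>.
\<close>

definition monic_coprime :: "'a :: field poly set \<Rightarrow> nat \<Rightarrow> 'a poly set" where
  "monic_coprime S n = {f. Polynomial.lead_coeff f = 1 \<and> Polynomial.degree f = n \<and> (\<forall>p\<in>S. \<not> p dvd f)}"

lemma finite_monic_coprime [simp]:
  "finite (monic_coprime S n :: 'a :: {field, finite} poly set)"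
  by (rule finite_subset[OF _ finite_polys_below[of "Suc n"]])
     (auto simp: monic_coprime_def polys_below_iff)

lemma card_monic_coprime_empty:
  "card (monic_coprime {} n :: 'a :: {field, finite} poly set) = CARD('a) ^ n"
proof -
  have "bij_betw (\<lambda>g. Polynomial.monom 1 n + g) (polys_below n) (monic_coprime {} n :: 'a poly set)"
  proof (rule bij_betwI')
    fix g :: "'a poly" assume g: "g \<in> polys_below n"
    have coeff: "Polynomial.coeff (Polynomial.monom 1 n + g) n = 1"
      using g by (simp add: polys_below_def)
    have "Polynomial.degree (Polynomial.monom 1 n + g) \<le> n"
      using g by (intro degree_le) (simp add: polys_below_def)
    moreover have "n \<le> Polynomial.degree (Polynomial.monom 1 n + g)"
      using coeff by (intro le_degree) simp
    ultimately have "Polynomial.degree (Polynomial.monom 1 n + g) = n" by (rule antisym)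
    with coeff show "Polynomial.monom 1 n + g \<in> monic_coprime {} n" by (simp add: monic_coprime_def)
  next
    fix f :: "'a poly" assume "f \<in> monic_coprime {} n"
    then have f: "Polynomial.coeff f n = 1" "Polynomial.degree f = n"
      by (auto simp: monic_coprime_def)
    then have "f - Polynomial.monom 1 n \<in> polys_below n"
      by (auto simp: polys_below_def coeff_eq_0 le_less)
    then show "\<exists>g\<in>polys_below n. f = Polynomial.monom 1 n + g"
      by (intro bexI[of _ "f - Polynomial.monom 1 n"]) simp_all
  qed simp
  then show ?thesis using card_polys_below bij_betw_same_card by metis
qed

text \<open>
  One step of the sieve: sieving by a further irreducible \<open>p\<close> removes the multiples \<open>p * h\<close>, and
  such a product had survived the earlier steps exactly when \<open>h\<close> had, because the irreducibles in
  \<open>S\<close> are prime and differ from \<open>p\<close>.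
\<close>

lemma card_monic_coprime_insert:
  fixes S :: "'a :: {field, finite} poly set"
  assumes p: "p \<in> monic_irreducibles" and S: "S \<subseteq> monic_irreducibles" and pS: "p \<notin> S"
  shows "card (monic_coprime S n) = card (monic_coprime (insert p S) n) +
    (if Polynomial.degree p \<le> n then card (monic_coprime S (n - Polynomial.degree p)) else 0)"
proof -
  let ?D = "{f \<in> monic_coprime S n. p dvd f}"
  have "monic_coprime S n = monic_coprime (insert p S) n \<union> ?D"
    by (auto simp: monic_coprime_def)
  moreover have "monic_coprime (insert p S) n \<inter> ?D = {}" by (auto simp: monic_coprime_def)
  ultimately have "card (monic_coprime S n) = card (monic_coprime (insert p S) n) + card ?D"
    by (metis card_Un_disjoint finite_Un finite_monic_coprime)
  moreover have "card ?D =
      (if Polynomial.degree p \<le> n then card (monic_coprime S (n - Polynomial.degree p)) else 0)"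
  proof (cases "Polynomial.degree p \<le> n")
    case False
    have "?D = {}"
    proof -
      have "Polynomial.degree p \<le> n" if "f \<in> ?D" for f
      proof -
        have "f \<noteq> 0" "Polynomial.degree f = n" "p dvd f" using that by (auto simp: monic_coprime_def)
        then show ?thesis using dvd_imp_degree_le by blast
      qed
      with False show ?thesis by blast
    qed
    then show ?thesis using False by simp
  next
    case True
    note P = monic_irreducibles_D[OF p]
    have "bij_betw (\<lambda>h. p * h) (monic_coprime S (n - Polynomial.degree p)) ?D"
    proof (rule bij_betwI')
      fix h h' :: "'a poly" show "(p * h = p * h') = (h = h')" using P(2) by simp
    next
      fix h assume h: "h \<in> monic_coprime S (n - Polynomial.degree p)"
      then have "h \<noteq> 0" by (auto simp: monic_coprime_def)
      have "\<not> p' dvd p * h" if p': "p' \<in> S" for p'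
      proof
        assume "p' dvd p * h"
        then have "p' dvd p \<or> p' dvd h"
          using monic_irreducibles_D(1)[of p'] S p' by (auto simp: prime_elem_dvd_mult_iff)
        moreover have "\<not> p' dvd p" using monic_irreducible_dvd_imp_eq p S pS p' by blast
        moreover have "\<not> p' dvd h" using h p' by (auto simp: monic_coprime_def)
        ultimately show False by blast
      qed
      moreover have "Polynomial.degree (p * h) = n"
        using h \<open>h \<noteq> 0\<close> P(2) True by (simp add: degree_mult_eq monic_coprime_def)
      moreover have "Polynomial.lead_coeff (p * h) = 1"
      proof -
        have "Polynomial.lead_coeff h = 1" using h unfolding monic_coprime_def by blast
        then show ?thesis by (simp only: lead_coeff_mult P(4) mult_1_left)
      qed
      ultimately show "p * h \<in> ?D"
        using dvd_triv_left[of p h] unfolding monic_coprime_def by blast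
    next
      fix f assume f: "f \<in> ?D"
      then obtain h where h: "f = p * h" by blast
      have F: "Polynomial.lead_coeff f = 1" "Polynomial.degree f = n" "\<And>p'. p' \<in> S \<Longrightarrow> \<not> p' dvd f"
        using f unfolding monic_coprime_def by blast+
      have "h \<noteq> 0" using F(1) h by auto
      have "Polynomial.degree h = n - Polynomial.degree p"
        using F(2) \<open>h \<noteq> 0\<close> P(2) by (simp add: h degree_mult_eq)
      moreover have "Polynomial.lead_coeff h = 1" using F(1) P(4) by (simp add: h lead_coeff_mult)
      moreover have "\<not> p' dvd h" if "p' \<in> S" for p' using F(3)[OF that] h by auto
      ultimately have "h \<in> monic_coprime S (n - Polynomial.degree p)"
        unfolding monic_coprime_def by blast
      with h show "\<exists>h\<in>monic_coprime S (n - Polynomial.degree p). f = p * h" by blast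
    qed
    then show ?thesis using True by (simp add: bij_betw_same_card)
  qed
  ultimately show ?thesis by simp
qed

text \<open>
  With the weight $q^{-n}$ the series for the empty sieve is the geometric series $1/(1-u)$, as there
  are $q^n$ monic polynomials of degree $n$.
\<close>

definition coprime_series :: "'a :: {field, finite} poly set \<Rightarrow> rat fps" where
  "coprime_series S = Abs_fps (\<lambda>n. of_nat (card (monic_coprime S n)) / of_nat CARD('a) ^ n)"

text \<open>
  A finite Euler product: each step of the sieve multiplies the series by one factor.
\<close>

lemma coprime_series_eq_prod:
  fixes S :: "'a :: {field, finite} poly set"
  assumes "finite S" "S \<subseteq> monic_irreducibles"
  shows "(1 - fps_X) * coprime_series S =
    (\<Prod>p\<in>S. 1 - fps_const (1 / of_nat CARD('a) ^ Polynomial.degree p) * fps_X ^ Polynomial.degree p)"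
  using assms
proof (induction S rule: finite_induct)
  case empty
  have "coprime_series ({} :: 'a poly set) = Abs_fps (\<lambda>_. 1)"
    by (simp add: coprime_series_def card_monic_coprime_empty)
  then have "(1 - fps_X) * coprime_series ({} :: 'a poly set) = 1"
    by (intro fps_ext) (simp add: left_diff_distrib)
  then show ?case by simp
next
  case (insert p S)
  let ?q = "of_nat CARD('a) :: rat"
  let ?k = "Polynomial.degree p"
  have p: "p \<in> monic_irreducibles" and S: "S \<subseteq> monic_irreducibles" using insert.prems by auto
  have "coprime_series (insert p S) =
      (1 - fps_const (1 / ?q ^ ?k) * fps_X ^ ?k) * coprime_series S"
  proof (rule fps_ext)
    fix n
    have "fps_nth ((1 - fps_const (1 / ?q ^ ?k) * fps_X ^ ?k) * coprime_series S) n =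
        fps_nth (coprime_series S) n -
          (if n < ?k then 0 else 1 / ?q ^ ?k * fps_nth (coprime_series S) (n - ?k))"
      by (simp add: left_diff_distrib mult.assoc fps_X_power_mult_nth)
    also have "\<dots> = fps_nth (coprime_series (insert p S)) n"
    proof (cases "n < ?k")
      case True
      then show ?thesis
        using card_monic_coprime_insert[OF p S insert.hyps(2), of n] by (simp add: coprime_series_def)
    next
      case False
      then have "?q ^ n = ?q ^ ?k * ?q ^ (n - ?k)" by (simp flip: power_add)
      then show ?thesis
        using False card_monic_coprime_insert[OF p S insert.hyps(2), of n]
        by (simp add: coprime_series_def add_divide_distrib)
    qed
    finally show "fps_nth (coprime_series (insert p S)) n =
      fps_nth ((1 - fps_const (1 / ?q ^ ?k) * fps_X ^ ?k) * coprime_series S) n" by simp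
  qed
  with insert S show ?case by (simp add: mult.left_commute)
qed

text \<open>
  A nonconstant polynomial of degree at most \<open>N\<close> has an irreducible factor of degree at most \<open>N\<close>,
  so up to degree \<open>N\<close> only the constant polynomial \<open>1\<close> survives the sieve. In the limit this is the
  Euler product of $1-u$.
\<close>

lemma nth_coprime_series_irreducibles_upto:
  assumes "n \<le> N"
  shows "fps_nth (coprime_series (monic_irreducibles_upto N :: 'a :: {field, finite} poly set)) n =
    (if n = 0 then 1 else 0)"
proof (cases "n = 0")
  case True
  have "monic_coprime (monic_irreducibles_upto N) 0 = {1 :: 'a poly}"
  proof (intro equalityI subsetI)
    fix f :: "'a poly" assume "f \<in> monic_coprime (monic_irreducibles_upto N) 0"
    then have f: "Polynomial.coeff f 0 = 1" "Polynomial.degree f = 0" by (auto simp: monic_coprime_def)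
    from f(2) obtain c where "f = [:c:]" by (rule degree_eq_zeroE)
    with f(1) show "f \<in> {1}" by (simp add: one_pCons)
  next
    fix f :: "'a poly" assume "f \<in> {1}"
    moreover have "\<not> p dvd 1" if "p \<in> (monic_irreducibles_upto N :: 'a poly set)" for p
      using that monic_irreducibles_D(1)[of p] prime_elem_not_unit[of p]
      unfolding monic_irreducibles_upto_def by blast
    ultimately show "f \<in> monic_coprime (monic_irreducibles_upto N) 0"
      by (simp add: monic_coprime_def)
  qed
  with True show ?thesis by (simp add: coprime_series_def)
next
  case False
  have "monic_coprime (monic_irreducibles_upto N) n = ({} :: 'a poly set)"
  proof -
    have False if f: "f \<in> monic_coprime (monic_irreducibles_upto N) n" for f :: "'a poly"
    proof -
      have deg: "Polynomial.degree f = n" and "f \<noteq> 0" using f by (auto simp: monic_coprime_def)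
      with False obtain p where p: "p \<in> monic_irreducibles" "p dvd f"
        using monic_irreducible_factor_exists[of f] by auto
      with deg \<open>f \<noteq> 0\<close> assms have "p \<in> monic_irreducibles_upto N"
        using dvd_imp_degree_le[of p f] by (simp add: monic_irreducibles_upto_def)
      with f p(2) show False by (auto simp: monic_coprime_def)
    qed
    then show ?thesis by blast
  qed
  with False show ?thesis by (simp add: coprime_series_def)
qed

lemma fps_nth_mult_eq_of_eq_upto:
  fixes F G H :: "'b :: comm_ring_1 fps"
  assumes "\<And>i. i \<le> n \<Longrightarrow> fps_nth F i = fps_nth G i"
  shows "fps_nth (H * F) n = fps_nth (H * G) n"
  unfolding fps_mult_nth by (rule sum.cong) (use assms in auto)

text \<open>
  In the $u$-adic topology a sequence of power series converges as soon as each coefficient is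
  eventually constant.
\<close>

lemma prodinf_fpsI:
  fixes f :: "nat \<Rightarrow> 'b :: idom fps"
  assumes "L \<noteq> 0" and "\<And>N n. n \<le> N \<Longrightarrow> fps_nth (\<Prod>d\<le>N. f d) n = fps_nth L n"
  shows "convergent_prod f \<and> (\<Prod>d. f d) = L"
proof -
  have "(\<lambda>N. \<Prod>d\<le>N. f d) \<longlonglongrightarrow> L"
  proof (rule tendsto_fpsI)
    fix n show "\<forall>\<^sub>F N in sequentially. fps_nth (\<Prod>d\<le>N. f d) n = fps_nth L n"
      using eventually_ge_at_top[of n] by eventually_elim (rule assms(2))
  qed
  with assms(1) have raw: "raw_has_prod f 0 L" by (simp add: raw_has_prod_def)
  then have "f has_prod L" by (simp add: has_prod_def)
  then have "(\<Prod>d. f d) = L" by (rule has_prod_unique[symmetric])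
  with raw show ?thesis by (auto simp: convergent_prod_def)
qed

text \<open>
  The second product comes from the first by the factorisation
  $1 + \frac{u^d(1-u^d)}{q^d(q^d-1)} = (1 + \frac{u^d}{q^d-1})(1 - \frac{u^d}{q^d})$: the additional
  factors multiply to $1-u$ by the sieve, which cancels against $1/(1-u)$.
\<close>

lemma squarefree_series_eq_products:
  fixes f g :: "nat \<Rightarrow> rat fps"
  defines "q \<equiv> CARD('a :: {field, finite})"
  assumes f: "\<And>d. f d = (1 + fps_X ^ d / fps_const (of_nat q ^ d - 1)) ^
      num_monic_irreducible TYPE('a) d"
    and g: "\<And>d. g d = (1 + fps_X ^ d * (1 - fps_X ^ d) /
      fps_const (of_nat q ^ d * (of_nat q ^ d - 1))) ^ num_monic_irreducible TYPE('a) d"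
  shows "convergent_prod (\<lambda>d. f (Suc d)) \<and> (\<Prod>d. f (Suc d)) = squarefree_series TYPE('a)"
    and "convergent_prod (\<lambda>d. g (Suc d)) \<and>
      1 / (1 - fps_X) * (\<Prod>d. g (Suc d)) = squarefree_series TYPE('a)"
proof -
  let ?L = "squarefree_series TYPE('a)"
  let ?q = "of_nat q :: rat"
  let ?I = "\<lambda>N. monic_irreducibles_upto N :: 'a poly set"
  let ?f = "\<lambda>p :: 'a poly. 1 + fps_const (1 / (?q ^ Polynomial.degree p - 1)) * fps_X ^ Polynomial.degree p"
  let ?r = "\<lambda>p :: 'a poly. 1 - fps_const (1 / ?q ^ Polynomial.degree p) * fps_X ^ Polynomial.degree p"
  have "card {0, 1 :: 'a} \<le> q" unfolding q_def by (rule card_mono) auto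
  then have q2: "?q \<ge> 2" by simp
  have fps_div: "F / fps_const c = fps_const (1 / c) * F" if "c \<noteq> 0" for F :: "rat fps" and c
    using that by (simp add: fps_divide_unit fps_const_inverse mult.commute field_simps)
  have pow: "?q ^ d \<noteq> 0" "?q ^ Suc d - 1 \<noteq> 0" for d
  proof -
    show "?q ^ d \<noteq> 0" using q2 by simp
    have "1 < ?q ^ Suc d" using q2 by (intro one_less_power) auto
    then show "?q ^ Suc d - 1 \<noteq> 0" by simp
  qed
  have F: "(\<Prod>d\<le>N. f (Suc d)) = (\<Prod>p\<in>?I (Suc N). ?f p)" for N
  proof -
    have "(\<Prod>d\<le>N. f (Suc d)) = (\<Prod>d\<le>N.
        (1 + fps_const (1 / (?q ^ Suc d - 1)) * fps_X ^ Suc d) ^ num_monic_irreducible TYPE('a) (Suc d))"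
      by (intro prod.cong refl) (simp only: f fps_div pow not_False_eq_True)
    then show ?thesis
      using prod_powers_eq_prod_irreducibles[where ?'a = 'a,
          of "\<lambda>d. 1 + fps_const (1 / (?q ^ d - 1)) * fps_X ^ d" N]
      by simp
  qed
  have fL: "fps_nth (\<Prod>p\<in>?I N. ?f p) n = fps_nth ?L n" if "n \<le> N" for N n
    using nth_prod_one_plus_irreducibles[OF that, where ?'a = 'a] by (simp add: q_def)
  have "fps_nth ?L 0 = 1" by (rule nth_squarefree_series_0)
  then have "?L \<noteq> 0" by auto
  moreover have "fps_nth (\<Prod>d\<le>N. f (Suc d)) n = fps_nth ?L n" if "n \<le> N" for N n
    unfolding F by (rule fL) (use that in simp)
  ultimately show "convergent_prod (\<lambda>d. f (Suc d)) \<and> (\<Prod>d. f (Suc d)) = ?L"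
    by (rule prodinf_fpsI)
  have G: "(\<Prod>d\<le>N. g (Suc d)) = (\<Prod>p\<in>?I (Suc N). ?f p) * (\<Prod>p\<in>?I (Suc N). ?r p)" for N
  proof -
    have "g (Suc d) = ((1 + fps_const (1 / (?q ^ Suc d - 1)) * fps_X ^ Suc d) *
        (1 - fps_const (1 / ?q ^ Suc d) * fps_X ^ Suc d)) ^ num_monic_irreducible TYPE('a) (Suc d)" for d
    proof -
      define x where "x = ?q ^ Suc d"
      define U where "U = (fps_X ^ Suc d :: rat fps)"
      have x: "x \<noteq> 0" "x - 1 \<noteq> 0" using pow[of "Suc d"] pow(2)[of d] by (simp_all add: x_def)
      \<comment> \<open>The constant is both the difference and the product of \<open>1 / (x - 1)\<close> and \<open>1 / x\<close>,
        which is what makes the factor split.\<close>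
      have c: "fps_const (1 / (x * (x - 1))) = fps_const (1 / (x - 1)) - fps_const (1 / x)"
        "fps_const (1 / (x * (x - 1))) = fps_const (1 / (x - 1)) * fps_const (1 / x)"
        using x by (simp_all add: field_simps)
      have "U * (1 - U) / fps_const (x * (x - 1)) = fps_const (1 / (x * (x - 1))) * (U * (1 - U))"
        by (rule fps_div) (use x in simp)
      then have "1 + U * (1 - U) / fps_const (x * (x - 1)) =
          1 + fps_const (1 / (x * (x - 1))) * U - fps_const (1 / (x * (x - 1))) * U * U"
        by (simp only: right_diff_distrib mult_1_right mult.assoc add_diff_eq)
      also have "\<dots> = 1 + (fps_const (1 / (x - 1)) - fps_const (1 / x)) * U -
          fps_const (1 / (x - 1)) * fps_const (1 / x) * U * U"
        by (subst c(1), subst c(2)) (rule refl)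
      also have "\<dots> = (1 + fps_const (1 / (x - 1)) * U) * (1 - fps_const (1 / x) * U)"
        by (simp add: algebra_simps del: fps_const_mult fps_const_sub fps_const_add)
      finally show ?thesis unfolding g x_def U_def by simp
    qed
    then show ?thesis
      using prod_powers_eq_prod_irreducibles[where ?'a = 'a,
          of "\<lambda>d. (1 + fps_const (1 / (?q ^ d - 1)) * fps_X ^ d) * (1 - fps_const (1 / ?q ^ d) * fps_X ^ d)" N]
      by (simp add: prod.distrib)
  qed
  have r: "(\<Prod>p\<in>?I N. ?r p) = (1 - fps_X) * coprime_series (?I N)" for N
  proof -
    have "?I N \<subseteq> monic_irreducibles" by (auto simp: monic_irreducibles_upto_def)
    from coprime_series_eq_prod[OF finite_monic_irreducibles_upto this] show ?thesis
      by (simp add: q_def)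
  qed
  have "fps_nth (\<Prod>d\<le>N. g (Suc d)) n = fps_nth ((1 - fps_X) * ?L) n" if n: "n \<le> N" for N n
  proof -
    have "fps_nth (\<Prod>d\<le>N. g (Suc d)) n =
        fps_nth ((1 - fps_X) * (\<Prod>p\<in>?I (Suc N). ?f p) * coprime_series (?I (Suc N))) n"
      unfolding G r by (simp add: mult_ac)
    also have "\<dots> = fps_nth ((1 - fps_X) * (\<Prod>p\<in>?I (Suc N). ?f p) * 1) n"
      by (rule fps_nth_mult_eq_of_eq_upto)
         (use n in \<open>simp add: nth_coprime_series_irreducibles_upto\<close>)
    also have "\<dots> = fps_nth ((1 - fps_X) * ?L) n"
      unfolding mult_1_right by (rule fps_nth_mult_eq_of_eq_upto, rule fL) (use n in simp)
    finally show ?thesis .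
  qed
  moreover have X1: "1 - fps_X \<noteq> (0 :: rat fps)"
  proof
    assume "1 - fps_X = (0 :: rat fps)"
    then have "fps_nth (1 - fps_X :: rat fps) 0 = 0" by simp
    then show False by simp
  qed
  moreover from X1 \<open>?L \<noteq> 0\<close> have "(1 - fps_X) * ?L \<noteq> 0" by simp
  ultimately have *: "convergent_prod (\<lambda>d. g (Suc d)) \<and> (\<Prod>d. g (Suc d)) = (1 - fps_X) * ?L"
    by (intro prodinf_fpsI) auto
  have "1 / (1 - fps_X) * (1 - fps_X) = (1 :: rat fps)"
    by (simp add: fps_divide_unit inverse_mult_eq_1)
  then have "1 / (1 - fps_X) * ((1 - fps_X) * ?L) = ?L"
    by (metis mult.assoc mult_1_left)
  with * show "convergent_prod (\<lambda>d. g (Suc d)) \<and> 1 / (1 - fps_X) * (\<Prod>d. g (Suc d)) = ?L" by simp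
qed


section \<open>Squarefree polynomials over a finite field have distinct roots\<close>

text \<open>
  The irreducible factors of \<open>f\<close> are prime, so each of them divides \<open>g\<close>; being distinct, their
  product divides \<open>g\<close> too.
\<close>

lemma squarefree_dvd_power_imp_dvd:
  fixes f g :: "'a :: field poly"
  assumes "Polynomial.lead_coeff f = 1" "squarefree f" and "f dvd g ^ k"
  shows "f dvd g"
proof -
  obtain S where S: "finite S" "S \<subseteq> monic_irreducibles" "f = \<Prod>S"
    using monic_squarefree_imp_prod[OF assms(1,2)] by blast
  have dvd: "p dvd g" if "p \<in> S" for p
  proof -
    have "p dvd f" using that S by (auto intro: dvd_prodI)
    then have "p dvd g ^ k" using assms(3) by (rule dvd_trans)
    then show ?thesis
      using prime_elem_dvd_power[of p g k] monic_irreducibles_D(1)[of p] S(2) that by blast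
  qed
  from S(1,2) dvd have "\<Prod>S dvd g"
  proof (induction rule: finite_induct)
    case (insert p S)
    then have p: "p \<in> monic_irreducibles" and S: "S \<subseteq> monic_irreducibles" by auto
    from insert S have "\<Prod>S dvd g" by simp
    then obtain e where e: "g = \<Prod>S * e" by blast
    have "p dvd g" using insert.prems(2) by simp
    moreover have "\<not> p dvd \<Prod>S"
      using monic_irreducible_dvd_prod_iff[OF S insert.hyps(1) p] insert.hyps(2) by simp
    ultimately have "p dvd e" using prime_elem_dvd_mult_iff monic_irreducibles_D(1)[OF p] e by blast
    then have "p * \<Prod>S dvd g" unfolding e by (metis dvd_refl mult.commute mult_dvd_mono)
    then show ?case using insert.hyps by simp
  qed simp
  with S(3) show ?thesis by simp
qed

text \<open>
  Let $p$ be the characteristic. The powers $x^{p^k}$ have only finitely many residues modulo $f$, so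
  $f$ divides $x^{p^j} - x^{p^i}$ for some $i < j$. This difference is the $p^i$-th power of
  $x^{p^{j-i}} - x$, and a squarefree polynomial dividing a power divides the base, so
  $Q = p^{j-i}$ serves.
\<close>

lemma squarefree_dvd_Frobenius_poly:
  fixes f :: "'a :: {field, finite} poly"
  assumes "Polynomial.lead_coeff f = 1" "squarefree f"
  shows "\<exists>Q. of_nat Q = (0 :: 'a) \<and> f dvd monom 1 Q - monom 1 1"
proof -
  define p where "p = CHAR('a)"
  have pos: "CHAR('a) > 0" by (rule finite_imp_CHAR_pos) simp
  then have prime: "Factorial_Ring.prime CHAR('a poly)" using prime_CHAR_semidom[where ?'a = 'a] by simp
  have p: "p = CHAR('a poly)" by (simp add: p_def)
  let ?X = "monom 1 1 :: 'a poly"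
  have "\<not> inj (\<lambda>k. ?X ^ (p ^ k) mod f)"
  proof
    assume "inj (\<lambda>k. ?X ^ (p ^ k) mod f)"
    moreover have "range (\<lambda>k. ?X ^ (p ^ k) mod f) \<subseteq> polys_below (Polynomial.degree f)"
      by (rule image_subsetI, rule mod_in_polys_below) (use assms(1) in auto)
    ultimately have "finite (UNIV :: nat set)"
      using finite_polys_below by (metis finite_subset finite_imageD)
    then show False by simp
  qed
  then obtain i j where ij: "i < j" "?X ^ (p ^ i) mod f = ?X ^ (p ^ j) mod f"
    unfolding inj_def by (metis linorder_neqE_nat)
  have "(?X ^ (p ^ (j - i)) - ?X) ^ (p ^ i) + ?X ^ (p ^ i) = (?X ^ (p ^ (j - i))) ^ (p ^ i)"
    using freshmans_dream'[OF prime, of "p ^ i" i "?X ^ (p ^ (j - i)) - ?X" ?X] p by simp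
  also have "\<dots> = ?X ^ (p ^ j)" using ij(1) by (simp flip: power_mult power_add)
  finally have "(?X ^ (p ^ (j - i)) - ?X) ^ (p ^ i) = ?X ^ (p ^ j) - ?X ^ (p ^ i)"
    by (simp add: algebra_simps)
  then have "f dvd (?X ^ (p ^ (j - i)) - ?X) ^ (p ^ i)" using ij(2) by (metis mod_eq_dvd_iff)
  then have "f dvd ?X ^ (p ^ (j - i)) - ?X"
    by (rule squarefree_dvd_power_imp_dvd[OF assms])
  moreover have "of_nat (p ^ (j - i)) = (0 :: 'a)" using ij(1) by (simp add: p_def)
  ultimately show ?thesis by (metis x_pow_n)
qed

interpretation to_ac: field_hom to_ac
  by unfold_locales auto

interpretation to_ac_poly: map_poly_inj_idom_hom to_ac ..

text \<open>
  The derivative of $x^Q - x$ is $-1$, so this polynomial has no repeated root in the algebraic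
  closure, and neither has its divisor \<open>f\<close>. This is the perfectness of finite fields in elementary
  form.
\<close>

lemma card_roots_squarefree:
  fixes f :: "'a :: {field, finite} poly"
  assumes "Polynomial.lead_coeff f = 1" "squarefree f"
  shows "card {x. poly (map_poly to_ac f) x = 0} = Polynomial.degree f"
proof -
  let ?F = "map_poly to_ac f"
  obtain Q where Q: "of_nat Q = (0 :: 'a)" "f dvd monom 1 Q - monom 1 1"
    using squarefree_dvd_Frobenius_poly[OF assms] by blast
  let ?G = "monom 1 Q - monom 1 1 :: 'a alg_closure poly"
  have "?F dvd map_poly to_ac (monom 1 Q - monom 1 1)"
    using Q(2) by (rule to_ac_poly.hom_dvd)
  also have "map_poly to_ac (monom 1 Q - monom 1 1) = ?G"
    by (simp add: to_ac_poly.hom_minus map_poly_monom)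
  finally have FG: "?F dvd ?G" .
  have "?F \<noteq> 0" using assms(1) by auto
  then obtain A where A: "size A = Polynomial.degree ?F"
    "?F = Polynomial.smult (Polynomial.lead_coeff ?F) (\<Prod>x\<in>#A. [:-x, 1:])"
    using alg_closed_imp_factorization by blast
  have F: "?F = (\<Prod>x\<in>#A. [:-x, 1:])" using A(2) assms(1) by simp
  have "count A x = 1" if x: "x \<in># A" for x
  proof (rule ccontr)
    assume "count A x \<noteq> 1"
    obtain B where B: "A = add_mset x B" using x by (rule mset_add)
    with \<open>count A x \<noteq> 1\<close> have "x \<in># B" by (simp add: not_in_iff)
    then obtain C where "A = add_mset x (add_mset x C)" using B by (metis mset_add)
    then have "[:-x, 1:] * [:-x, 1:] dvd ?F"
      unfolding F by (simp add: mult.assoc[symmetric] del: mult_pCons_left mult_pCons_right)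
    with FG obtain H where H: "?G = [:-x, 1:] * [:-x, 1:] * H" by (meson dvd_trans dvdE)
    have "of_nat Q = (0 :: 'a alg_closure)" using Q(1) by (metis to_ac_0 to_ac_of_nat)
    then have "pderiv ?G = - 1" by (simp add: pderiv_diff pderiv_monom one_pCons monom_0)
    moreover have "poly (pderiv ?G) x = 0" unfolding H
      by (simp add: pderiv_mult del: mult_pCons_left mult_pCons_right)
    ultimately show False by simp
  qed
  then have "card (set_mset A) = size A" by (simp add: size_multiset_overloaded_eq)
  moreover have "{x. poly ?F x = 0} = set_mset A"
    unfolding F by (auto simp: poly_prod_mset)
  ultimately show ?thesis using A(1) by simp
qed


unbundle no vec_syntax
no_notation fps_nth (infixl \<open>$\<close> 75)

section \<open>Polynomials in a matrix acting on vectors\<close>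

text \<open>
  The vector $g(A)v$, computed by Horner's scheme: induction over the coefficients of the polynomial
  then requires no powers of the matrix.
\<close>

definition poly_act :: "'a :: field mat \<Rightarrow> 'a poly \<Rightarrow> 'a vec \<Rightarrow> 'a vec" where
  "poly_act A g v = fold_coeffs (\<lambda>a w. a \<cdot>\<^sub>v v + A *\<^sub>v w) g (0\<^sub>v (dim_vec v))"

context
  fixes A :: "'a :: field mat" and n :: nat
  assumes A: "A \<in> carrier_mat n n"
begin

lemma poly_act_0 [simp]: "v \<in> carrier_vec n \<Longrightarrow> poly_act A 0 v = 0\<^sub>v n"
  by (simp add: poly_act_def)

lemma poly_act_pCons:
  assumes v: "v \<in> carrier_vec n"
  shows "poly_act A (pCons a g) v = a \<cdot>\<^sub>v v + A *\<^sub>v poly_act A g v"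
proof (cases "a = 0 \<and> g = 0")
  case True
  then show ?thesis using A v by (auto simp: poly_act_def scalar_prod_def intro!: eq_vecI)
next
  case False
  then show ?thesis unfolding poly_act_def by (cases "a = 0") simp_all
qed

lemma poly_act_carrier [simp]:
  assumes v: "v \<in> carrier_vec n"
  shows "poly_act A g v \<in> carrier_vec n"
  by (induction g) (use A v in \<open>auto simp: poly_act_pCons[OF v]\<close>)

lemma poly_act_add:
  assumes v: "v \<in> carrier_vec n"
  shows "poly_act A (g + h) v = poly_act A g v + poly_act A h v"
proof (induction g arbitrary: h)
  case 0
  then show ?case using v by simp
next
  case (pCons a g)
  obtain b k where h: "h = pCons b k" by (rule pCons_cases)
  have car: "poly_act A g v \<in> carrier_vec n" "poly_act A k v \<in> carrier_vec n" using v by simp_all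
  have "A *\<^sub>v (poly_act A g v + poly_act A k v) = A *\<^sub>v poly_act A g v + A *\<^sub>v poly_act A k v"
    by (rule mult_add_distrib_mat_vec[OF A car])
  moreover have "A *\<^sub>v poly_act A g v \<in> carrier_vec n" "A *\<^sub>v poly_act A k v \<in> carrier_vec n"
    using A car by auto
  ultimately show ?case using A v unfolding h
    by (simp add: poly_act_pCons[OF v] pCons.IH) (intro eq_vecI, auto simp: algebra_simps)
qed

lemma poly_act_smult:
  assumes v: "v \<in> carrier_vec n"
  shows "poly_act A (Polynomial.smult c g) v = c \<cdot>\<^sub>v poly_act A g v"
proof (induction g)
  case 0
  then show ?case using v by (auto intro!: eq_vecI)
next
  case (pCons a g)
  have car: "poly_act A g v \<in> carrier_vec n" using v by simp
  have "A *\<^sub>v (c \<cdot>\<^sub>v poly_act A g v) = c \<cdot>\<^sub>v (A *\<^sub>v poly_act A g v)"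
    by (rule mult_mat_vec[OF A car])
  moreover have "A *\<^sub>v poly_act A g v \<in> carrier_vec n" using A car by auto
  ultimately show ?case using A v
    by (simp add: poly_act_pCons[OF v] pCons.IH) (intro eq_vecI, auto simp: algebra_simps)
qed

lemma poly_act_diff:
  assumes v: "v \<in> carrier_vec n"
  shows "poly_act A (g - h) v = poly_act A g v - poly_act A h v"
proof -
  have "poly_act A (g - h) v \<in> carrier_vec n" "poly_act A h v \<in> carrier_vec n"
    using v by simp_all
  then have "poly_act A (g - h) v = (poly_act A (g - h) v + poly_act A h v) - poly_act A h v"
    by (intro eq_vecI) auto
  then show ?thesis using poly_act_add[OF v, of "g - h" h] by simp
qed

lemma poly_act_mult:
  assumes v: "v \<in> carrier_vec n"
  shows "poly_act A (g * h) v = poly_act A g (poly_act A h v)"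
proof (induction g)
  case 0
  then show ?case using v by simp
next
  case (pCons a g)
  have car: "poly_act A h v \<in> carrier_vec n" using v by simp
  have car2: "A *\<^sub>v poly_act A g (poly_act A h v) \<in> carrier_vec n" using A car by auto
  have "0 \<cdot>\<^sub>v v + A *\<^sub>v poly_act A g (poly_act A h v) = A *\<^sub>v poly_act A g (poly_act A h v)"
    using A v car2 by (intro eq_vecI) auto
  then show ?case using v car
    by (simp add: poly_act_pCons poly_act_add poly_act_smult pCons.IH)
qed

lemma poly_act_1 [simp]:
  assumes v: "v \<in> carrier_vec n"
  shows "poly_act A 1 v = v"
proof -
  have "A *\<^sub>v 0\<^sub>v n = 0\<^sub>v n" using A by (intro eq_vecI) (auto simp: scalar_prod_def)
  then show ?thesis using v by (simp add: one_pCons poly_act_pCons)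
qed

lemma poly_act_pCons_0:
  assumes v: "v \<in> carrier_vec n"
  shows "poly_act A (pCons 0 g) v = A *\<^sub>v poly_act A g v"
    and "poly_act A (pCons 0 g) v = poly_act A g (A *\<^sub>v v)"
proof -
  have *: "poly_act A (pCons 0 g) v = A *\<^sub>v poly_act A g v" if "v \<in> carrier_vec n" for g v
  proof -
    have "A *\<^sub>v poly_act A g v \<in> carrier_vec n" using A that by auto
    then show ?thesis using A that by (simp add: poly_act_pCons) (intro eq_vecI, auto)
  qed
  then show "poly_act A (pCons 0 g) v = A *\<^sub>v poly_act A g v" using v by simp
  have "pCons 0 g = g * pCons 0 1" by simp
  also have "poly_act A \<dots> v = poly_act A g (A *\<^sub>v v)"
    using v by (simp add: poly_act_mult * del: mult_pCons_right)
  finally show "poly_act A (pCons 0 g) v = poly_act A g (A *\<^sub>v v)" .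
qed

lemma poly_act_monom:
  assumes v: "v \<in> carrier_vec n"
  shows "poly_act A (Polynomial.monom 1 k) v = (A ^\<^sub>m k) *\<^sub>v v"
  using v
proof (induction k arbitrary: v)
  case 0
  have "(1\<^sub>m n :: 'a mat) = A ^\<^sub>m 0" using A by simp
  then show ?case using 0 by (simp add: monom_0 flip: one_pCons) (metis one_mult_mat_vec)
next
  case (Suc k)
  have "(A ^\<^sub>m k * A) *\<^sub>v v = A ^\<^sub>m k *\<^sub>v (A *\<^sub>v v)"
    using A Suc.prems by (intro assoc_mult_mat_vec[of _ n n _ n]) auto
  then show ?case using Suc A by (simp add: monom_Suc poly_act_pCons_0(2))
qed

text \<open>
  Read entry by entry, this expresses $g(A)v$ as a matrix applied to the coefficients of $g$, the
  columns of the matrix being $A^j v$.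
\<close>

lemma poly_act_expand:
  assumes v: "v \<in> carrier_vec n" and g: "g \<in> polys_below m" and i: "i < n"
  shows "poly_act A g v $ i = (\<Sum>j<m. Polynomial.coeff g j * poly_act A (Polynomial.monom 1 j) v $ i)"
  using v g
proof (induction m arbitrary: g v)
  case 0
  then show ?case using i by (simp add: polys_below_0)
next
  case (Suc m)
  obtain a h where gh: "g = pCons a h" by (rule pCons_cases)
  have h: "h \<in> polys_below m" using Suc.prems by (simp only: gh pCons_in_polys_below)
  have Av: "A *\<^sub>v v \<in> carrier_vec n" using A Suc.prems by auto
  have car: "poly_act A h (A *\<^sub>v v) \<in> carrier_vec n" using Av by simp
  have "poly_act A g v = a \<cdot>\<^sub>v v + poly_act A h (A *\<^sub>v v)"
    unfolding gh using poly_act_pCons[OF Suc.prems(1), of a h] poly_act_pCons_0[OF Suc.prems(1), of h]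
    by simp
  then have "poly_act A g v $ i = a * v $ i + poly_act A h (A *\<^sub>v v) $ i"
    using car i Suc.prems(1) by simp
  also have "\<dots> = a * v $ i +
      (\<Sum>j<m. Polynomial.coeff h j * poly_act A (Polynomial.monom 1 (Suc j)) v $ i)"
    using Suc.IH[OF Av h] Suc.prems(1) by (simp add: monom_Suc poly_act_pCons_0(2))
  also have "\<dots> = (\<Sum>j<Suc m. Polynomial.coeff g j * poly_act A (Polynomial.monom 1 j) v $ i)"
    using Suc.prems(1)
    by (simp add: gh sum.lessThan_Suc_shift monom_0 del: sum.lessThan_Suc flip: one_pCons)
  finally show ?case .
qed

end

definition cyclic_vec :: "'a :: field mat \<Rightarrow> 'a vec \<Rightarrow> bool" where
  "cyclic_vec A v \<longleftrightarrow> v \<in> carrier_vec (dim_row A) \<and>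
     (\<forall>w \<in> carrier_vec (dim_row A). \<exists>g. poly_act A g v = w)"

text \<open>
  The span of the orbit of \<open>v\<close> is the cyclic module of all $g(A)v$. From here on cyclicity is
  treated as surjectivity of \<open>g \<mapsto> g(A)v\<close>, without reference to spans.
\<close>

lemma range_poly_act_eq_span:
  fixes A :: "'a :: field mat"
  assumes A: "A \<in> carrier_mat n n" and v: "v \<in> carrier_vec n"
  shows "LinearCombinations.module.span class_ring (module_vec TYPE('a) n)
           (range (\<lambda>i :: nat. (A ^\<^sub>m i) *\<^sub>v v)) = range (\<lambda>g. poly_act A g v)"
proof -
  interpret vec_space "TYPE('a)" n .
  let ?S = "range (\<lambda>i :: nat. (A ^\<^sub>m i) *\<^sub>v v)"
  have S: "?S \<subseteq> carrier_vec n" using A v by (auto intro!: mult_mat_vec_carrier)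
  have S_act: "?S = range (\<lambda>i. poly_act A (Polynomial.monom 1 i) v)"
    using poly_act_monom[OF A v] by simp
  note [simp] = poly_act_carrier[OF A v]
  show ?thesis
  proof (intro equalityI subsetI)
    fix w assume "w \<in> span ?S"
    then obtain a B where B: "finite B" "B \<subseteq> ?S" "w = lincomb a B" by (auto simp: span_def)
    from B(1,2) have "lincomb a B \<in> range (\<lambda>g. poly_act A g v)"
    proof (induction B rule: finite_induct)
      case empty
      have "lincomb a {} = poly_act A 0 v" using A v by (simp add: lincomb_def poly_act_0)
      then show ?case by blast
    next
      case (insert b B)
      then obtain g i where g: "lincomb a B = poly_act A g v" and b: "b = poly_act A (Polynomial.monom 1 i) v"
        unfolding S_act by blast
      have "lincomb a (insert b B) = a b \<cdot>\<^sub>v b + lincomb a B"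
        using insert S by (intro lincomb_insert2) auto
      also have "\<dots> = poly_act A (Polynomial.smult (a b) (Polynomial.monom 1 i) + g) v"
        by (simp only: poly_act_add[OF A v] poly_act_smult[OF A v] g b)
      finally show ?case by blast
    qed
    with B show "w \<in> range (\<lambda>g. poly_act A g v)" by simp
  next
    fix w assume "w \<in> range (\<lambda>g. poly_act A g v)"
    then obtain g where w: "w = poly_act A g v" by blast
    have "0\<^sub>v n = lincomb (\<lambda>_. 0) {}" by (simp add: lincomb_def)
    then have zero: "0\<^sub>v n \<in> span ?S" unfolding span_def by blast
    have "poly_act A (g * Polynomial.monom 1 k) v \<in> span ?S" for k
    proof (induction g arbitrary: k)
      case 0
      then show ?case using poly_act_0[OF A v] zero by simp
    next
      case (pCons a g)
      have "Polynomial.monom 1 k * pCons a g = Polynomial.smult a (Polynomial.monom 1 k) + g * Polynomial.monom 1 (Suc k)"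
        by (simp add: monom_Suc mult.commute)
      moreover have "poly_act A (Polynomial.monom 1 k) v \<in> span ?S"
        using in_own_span[OF S] S_act by auto
      ultimately show ?case
        using pCons.IH[of "Suc k"] S
        by (simp add: mult.commute poly_act_add[OF A v] poly_act_smult[OF A v] span_add1 smult_in_span)
    qed
    from this[of 0] show "w \<in> span ?S" by (simp add: w monom_0 flip: one_pCons)
  qed
qed

lemma cyclic_mat_iff_cyclic_vec:
  assumes A: "A \<in> carrier_mat n n"
  shows "cyclic_mat A \<longleftrightarrow> (\<exists>v. cyclic_vec A v)"
proof -
  have "range (\<lambda>g. poly_act A g v) = carrier_vec n \<longleftrightarrow>
      (\<forall>w \<in> carrier_vec n. \<exists>g. poly_act A g v = w)" if "v \<in> carrier_vec n" for v
  proof (intro iffI ballI)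
    fix w :: "'a vec" assume "range (\<lambda>g. poly_act A g v) = carrier_vec n" "w \<in> carrier_vec n"
    then have "w \<in> range (\<lambda>g. poly_act A g v)" by simp
    then show "\<exists>g. poly_act A g v = w" by blast
  next
    assume *: "\<forall>w \<in> (carrier_vec n :: 'a vec set). \<exists>g. poly_act A g v = w"
    have "carrier_vec n \<subseteq> range (\<lambda>g. poly_act A g v)"
    proof
      fix w :: "'a vec" assume "w \<in> carrier_vec n"
      with * obtain g where "poly_act A g v = w" by blast
      then show "w \<in> range (\<lambda>g. poly_act A g v)" by blast
    qed
    then show "range (\<lambda>g. poly_act A g v) = carrier_vec n"
      using poly_act_carrier[OF A that] by blast
  qed
  then show ?thesis
    using A range_poly_act_eq_span[OF A] unfolding cyclic_mat_def cyclic_vec_def by auto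
qed


section \<open>Coordinates and invertible matrices\<close>

definition coeff_vec :: "nat \<Rightarrow> 'a :: zero poly \<Rightarrow> 'a vec" where
  "coeff_vec n g = vec n (Polynomial.coeff g)"

lemma coeff_vec_carrier [simp]: "coeff_vec n g \<in> carrier_vec n"
  by (simp add: coeff_vec_def)

lemma coeff_vec_index [simp]: "i < n \<Longrightarrow> coeff_vec n g $ i = Polynomial.coeff g i"
  by (simp add: coeff_vec_def)

lemma coeff_vec_0 [simp]: "coeff_vec n 0 = 0\<^sub>v n"
  by (intro eq_vecI) (simp_all add: coeff_vec_def)

lemma coeff_vec_surj:
  assumes "w \<in> carrier_vec n"
  shows "\<exists>g \<in> polys_below n. w = coeff_vec n g"
proof
  let ?g = "Poly (map (\<lambda>i. w $ i) [0..<n])"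
  show "w = coeff_vec n ?g"
    using assms by (intro eq_vecI) (simp_all add: coeff_vec_def nth_default_def)
  show "?g \<in> polys_below n" by (simp add: polys_below_def nth_default_def)
qed

lemma coeff_vec_inj:
  assumes "g \<in> polys_below n" "h \<in> polys_below n" "coeff_vec n g = coeff_vec n h"
  shows "g = h"
proof (rule poly_eqI)
  fix i show "Polynomial.coeff g i = Polynomial.coeff h i"
  proof (cases "i < n")
    case True
    then show ?thesis using arg_cong[OF assms(3), of "\<lambda>w. w $ i"] by simp
  qed (use assms in \<open>simp add: polys_below_def\<close>)
qed

lemma bij_betw_coeff_vec: "bij_betw (coeff_vec n) (polys_below n) (carrier_vec n)"
proof (rule bij_betwI')
  show "(coeff_vec n g = coeff_vec n h) = (g = h)"
    if "g \<in> polys_below n" "h \<in> polys_below n" for g h :: "'a poly"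
    using coeff_vec_inj[OF that] by blast
  show "\<exists>g\<in>polys_below n. w = coeff_vec n g" if "w \<in> carrier_vec n" for w :: "'a vec"
    using that by (rule coeff_vec_surj)
qed simp

lemma finite_carrier_vec [simp]: "finite (carrier_vec n :: 'a :: {zero, finite} vec set)"
  using bij_betw_finite[OF bij_betw_coeff_vec[of n, where ?'a = 'a]] by simp

lemma card_carrier_vec: "card (carrier_vec n :: 'a :: {zero, finite} vec set) = CARD('a) ^ n"
  using bij_betw_same_card[OF bij_betw_coeff_vec[of n, where ?'a = 'a]]
  by (simp add: card_polys_below)

lemma mat_eqI_mult_vec:
  fixes A B :: "'a :: semiring_1 mat"
  assumes A: "A \<in> carrier_mat n n" and B: "B \<in> carrier_mat n n"
    and eq: "\<And>w. w \<in> carrier_vec n \<Longrightarrow> A *\<^sub>v w = B *\<^sub>v w"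
  shows "A = B"
proof (rule eq_matI)
  fix i j assume ij: "i < dim_row B" "j < dim_col B"
  have "(A *\<^sub>v unit_vec n j) $ i = (B *\<^sub>v unit_vec n j) $ i" by (simp add: eq)
  then show "A $$ (i, j) = B $$ (i, j)" using A B ij by simp
qed (use A B in auto)

lemma invertible_mat_iff:
  fixes A :: "'a :: semiring_1 mat"
  assumes A: "A \<in> carrier_mat n n"
  shows "invertible_mat A \<longleftrightarrow> (\<exists>B \<in> carrier_mat n n. A * B = 1\<^sub>m n \<and> B * A = 1\<^sub>m n)"
proof
  assume "invertible_mat A"
  then obtain B where B: "A * B = 1\<^sub>m n" "B * A = 1\<^sub>m (dim_row B)"
    using A unfolding invertible_mat_def inverts_mat_def by auto
  have "dim_col B = n" using arg_cong[OF B(1), of dim_col] by simp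
  moreover have "dim_row B = n" using arg_cong[OF B(2), of dim_col] A by simp
  ultimately show "\<exists>B \<in> carrier_mat n n. A * B = 1\<^sub>m n \<and> B * A = 1\<^sub>m n" using B by auto
next
  assume "\<exists>B \<in> carrier_mat n n. A * B = 1\<^sub>m n \<and> B * A = 1\<^sub>m n"
  then show "invertible_mat A" using A unfolding invertible_mat_def inverts_mat_def by auto
qed

lemma inverse_mat_exists:
  fixes A :: "'a :: field mat"
  assumes A: "A \<in> carrier_mat n n"
    and kernel: "\<And>w. w \<in> carrier_vec n \<Longrightarrow> A *\<^sub>v w = 0\<^sub>v n \<Longrightarrow> w = 0\<^sub>v n"
  shows "\<exists>B \<in> carrier_mat n n. A * B = 1\<^sub>m n \<and> B * A = 1\<^sub>m n"
proof -
  have "det A \<noteq> 0" using det_0_iff_vec_prod_zero_field[OF A] kernel by blast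
  from det_non_zero_imp_unit[OF A this, of "()"] show ?thesis
    by (auto simp: Units_def ring_mat_def)
qed

section \<open>Cyclic vectors and their annihilators\<close>

text \<open>
  The polynomials annihilating \<open>v\<close> are the multiples of one of least degree. Modulo this polynomial
  \<open>f\<close> the map $g \mapsto g(A)v$ is a bijection onto the $q^n$ vectors, and since there are
  $q^{\deg f}$ residues the degree of \<open>f\<close> must be \<open>n\<close>.
\<close>

lemma annihilator_exists:
  fixes A :: "'a :: {field, finite} mat"
  assumes A: "A \<in> carrier_mat n n" and cyc: "cyclic_vec A v"
  shows "\<exists>f. Polynomial.lead_coeff f = 1 \<and> Polynomial.degree f = n \<and>
    (\<forall>g. poly_act A g v = 0\<^sub>v n \<longleftrightarrow> f dvd g)"
proof -
  have v: "v \<in> carrier_vec n" and surj: "\<And>w. w \<in> carrier_vec n \<Longrightarrow> \<exists>g. poly_act A g v = w"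
    using A cyc by (auto simp: cyclic_vec_def)
  note car = poly_act_carrier[OF A v]
  have q: "CARD('a) \<ge> 2"
    using card_mono[of "UNIV :: 'a set" "{0, 1}"] by simp
  \<comment> \<open>There are more polynomials of degree at most \<open>n\<close> than vectors, so some nonzero one kills \<open>v\<close>.\<close>
  have "\<not> inj_on (\<lambda>g. poly_act A g v) (polys_below (Suc n))"
  proof
    assume "inj_on (\<lambda>g. poly_act A g v) (polys_below (Suc n))"
    moreover have "(\<lambda>g. poly_act A g v) ` polys_below (Suc n) \<subseteq> carrier_vec n" using car by auto
    ultimately have "card (polys_below (Suc n) :: 'a poly set) \<le> card (carrier_vec n :: 'a vec set)"
      by (intro card_inj_on_le) simp_all
    then have "CARD('a) * CARD('a) ^ n \<le> 1 * CARD('a) ^ n"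
      by (simp add: card_polys_below card_carrier_vec)
    then show False using q by (simp only: mult_le_cancel2) simp
  qed
  then obtain g h where gh: "g \<noteq> h" "poly_act A g v = poly_act A h v"
    by (auto simp: inj_on_def)
  have "poly_act A (g - h) v = 0\<^sub>v n"
    using gh(2) car[of h] by (simp add: poly_act_diff[OF A v])
  define P where "P d \<longleftrightarrow> (\<exists>f. f \<noteq> 0 \<and> poly_act A f v = 0\<^sub>v n \<and> Polynomial.degree f = d)" for d
  have "P (Polynomial.degree (g - h))"
    unfolding P_def using gh(1) \<open>poly_act A (g - h) v = 0\<^sub>v n\<close> by (intro exI[of _ "g - h"]) simp
  then have "P (LEAST d. P d)" by (rule LeastI)
  then obtain f0 where f0: "f0 \<noteq> 0" "poly_act A f0 v = 0\<^sub>v n" "Polynomial.degree f0 = (LEAST d. P d)"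
    unfolding P_def by blast
  have least: "Polynomial.degree f0 \<le> Polynomial.degree f" if "f \<noteq> 0" "poly_act A f v = 0\<^sub>v n" for f
    unfolding f0(3) by (rule Least_le) (use that in \<open>auto simp: P_def\<close>)
  define f where "f = Polynomial.smult (inverse (Polynomial.lead_coeff f0)) f0"
  have f: "Polynomial.lead_coeff f = 1" "Polynomial.degree f = Polynomial.degree f0" "f \<noteq> 0"
    using f0(1) by (auto simp: f_def)
  have f_kills: "poly_act A f v = 0\<^sub>v n"
    using f0(2) by (simp add: f_def poly_act_smult[OF A v]) (intro eq_vecI, auto)
  have multiple: "poly_act A (h * f) v = 0\<^sub>v n" for h
  proof -
    have "poly_act A (h * f) v = poly_act A h (0\<^sub>v n)" using poly_act_mult[OF A v, of h f] f_kills by simp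
    also have "\<dots> = poly_act A h (poly_act A 0 v)" using poly_act_0[OF A v] by simp
    also have "\<dots> = poly_act A (h * 0) v" using poly_act_mult[OF A v, of h 0] by simp
    also have "\<dots> = 0\<^sub>v n" using poly_act_0[OF A v] by simp
    finally show ?thesis .
  qed
  have mod: "poly_act A (g mod f) v = poly_act A g v" for g
  proof -
    have "poly_act A g v = poly_act A (g div f * f + g mod f) v" by simp
    also have "\<dots> = poly_act A (g mod f) v"
      unfolding poly_act_add[OF A v] multiple using car[of "g mod f"] by simp
    finally show ?thesis by simp
  qed
  have kernel: "poly_act A g v = 0\<^sub>v n \<longleftrightarrow> f dvd g" for g
  proof
    assume "poly_act A g v = 0\<^sub>v n"
    with mod have zero: "poly_act A (g mod f) v = 0\<^sub>v n" by (rule trans)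
    have "g mod f = 0"
    proof (rule ccontr)
      assume nz: "g mod f \<noteq> 0"
      with mod_in_polys_below[OF f(3), of g] have "Polynomial.degree (g mod f) < Polynomial.degree f"
        unfolding polys_below_iff by blast
      with least[OF nz zero] f(2) show False by simp
    qed
    then show "f dvd g" by auto
  qed (metis dvdE mult.commute multiple)
  have "bij_betw (\<lambda>g. poly_act A g v) (polys_below (Polynomial.degree f)) (carrier_vec n)"
  proof (rule bij_betwI')
    fix g h :: "'a poly"
    assume gh: "g \<in> polys_below (Polynomial.degree f)" "h \<in> polys_below (Polynomial.degree f)"
    show "(poly_act A g v = poly_act A h v) = (g = h)"
    proof
      assume "poly_act A g v = poly_act A h v"
      then have "poly_act A (g - h) v = 0\<^sub>v n"
        using car[of h] by (simp add: poly_act_diff[OF A v])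
      then show "g = h" using kernel polys_below_cong_imp_eq[OF gh] by blast
    qed simp
  next
    fix w :: "'a vec" assume "w \<in> carrier_vec n"
    then obtain g where "poly_act A g v = w" using surj by blast
    then show "\<exists>g\<in>polys_below (Polynomial.degree f). w = poly_act A g v"
      using mod[of g] mod_in_polys_below[OF f(3), of g] by (intro bexI[of _ "g mod f"]) simp_all
  qed (use car in simp)
  then have "CARD('a) ^ Polynomial.degree f = CARD('a) ^ n"
    by (metis bij_betw_same_card card_polys_below card_carrier_vec)
  then have "Polynomial.degree f = n" using q by (simp add: power_inject_exp)
  with f(1) kernel show ?thesis by blast
qed

text \<open>
  Meant for monic \<open>f\<close>, which is then the annihilator of \<open>v\<close> and the minimal polynomial of \<open>A\<close>.
  The size of the matrices is read off from the degree of \<open>f\<close>.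
\<close>

definition cyclic_pairs :: "'a :: field poly \<Rightarrow> ('a mat \<times> 'a vec) set" where
  "cyclic_pairs f = {(A, v). A \<in> carrier_mat (Polynomial.degree f) (Polynomial.degree f) \<and>
     cyclic_vec A v \<and> poly_act A f v = 0\<^sub>v (Polynomial.degree f)}"

lemma cyclic_pairs_D:
  assumes "(A, v) \<in> cyclic_pairs f"
  shows "A \<in> carrier_mat (Polynomial.degree f) (Polynomial.degree f)"
    "v \<in> carrier_vec (Polynomial.degree f)" "cyclic_vec A v"
    "poly_act A f v = 0\<^sub>v (Polynomial.degree f)"
  using assms by (auto simp: cyclic_pairs_def cyclic_vec_def)

lemma cyclic_vec_surj:
  assumes "(A, v) \<in> cyclic_pairs f" "w \<in> carrier_vec (Polynomial.degree f)"
  shows "\<exists>g. poly_act A g v = w"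
  using assms by (auto simp: cyclic_pairs_def cyclic_vec_def)

lemma monic_dvd_same_degree_imp_eq:
  fixes f g :: "'a :: field poly"
  assumes "f dvd g" "Polynomial.lead_coeff f = 1" "Polynomial.lead_coeff g = 1"
    "Polynomial.degree f = Polynomial.degree g"
  shows "f = g"
proof -
  obtain c where c: "g = f * c" using assms(1) by blast
  have "f \<noteq> 0" "c \<noteq> 0" using assms c by auto
  then have "Polynomial.degree c = 0" using assms(4) by (simp add: c degree_mult_eq)
  then obtain a where "c = [:a:]" by (rule degree_eq_zeroE)
  moreover have "Polynomial.lead_coeff c = 1" using assms(2,3) by (simp add: c lead_coeff_mult)
  ultimately show ?thesis by (simp add: c one_pCons)
qed

lemma cyclic_pairs_kernel:
  fixes f :: "'a :: {field, finite} poly"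
  assumes pair: "(A, v) \<in> cyclic_pairs f" and monic: "Polynomial.lead_coeff f = 1"
  shows "poly_act A g v = 0\<^sub>v (Polynomial.degree f) \<longleftrightarrow> f dvd g"
proof -
  note D = cyclic_pairs_D[OF pair]
  obtain f' where f': "Polynomial.lead_coeff f' = 1" "Polynomial.degree f' = Polynomial.degree f"
    "\<And>g. poly_act A g v = 0\<^sub>v (Polynomial.degree f) \<longleftrightarrow> f' dvd g"
    using annihilator_exists[OF D(1,3)] by blast
  have "f' dvd f" using f'(3) D(4) by blast
  then have "f' = f" using monic_dvd_same_degree_imp_eq f' monic by blast
  with f'(3) show ?thesis by blast
qed

lemma cyclic_pairs_annihilates:
  assumes pair: "(A, v) \<in> cyclic_pairs f" and w: "w \<in> carrier_vec (Polynomial.degree f)"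
  shows "poly_act A f w = 0\<^sub>v (Polynomial.degree f)"
proof -
  note D = cyclic_pairs_D[OF pair]
  obtain g where g: "poly_act A g v = w" using cyclic_vec_surj[OF pair w] by blast
  have "poly_act A f w = poly_act A (g * f) v"
    using poly_act_mult[OF D(1,2), of f g] g by (simp add: mult.commute)
  also have "\<dots> = poly_act A g (poly_act A 0 v)"
    using poly_act_mult[OF D(1,2), of g f] D(4) poly_act_0[OF D(1,2)] by simp
  also have "\<dots> = poly_act A (g * 0) v" using poly_act_mult[OF D(1,2), of g 0] by simp
  also have "\<dots> = 0\<^sub>v (Polynomial.degree f)" using poly_act_0[OF D(1,2)] by simp
  finally show ?thesis .
qed

text \<open>
  Every vector has the form $g(A)v$, and $f'(A)$ commutes with $g(A)$, so the annihilator of one cyclic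
  vector annihilates all others. Hence the polynomial depends on the matrix alone.
\<close>

lemma cyclic_pairs_unique:
  fixes f f' :: "'a :: {field, finite} poly"
  assumes "(A, v) \<in> cyclic_pairs f" "(A, v') \<in> cyclic_pairs f'"
    and "Polynomial.lead_coeff f = 1" "Polynomial.lead_coeff f' = 1"
  shows "f = f'"
proof -
  have deg: "Polynomial.degree f = Polynomial.degree f'"
    using cyclic_pairs_D(1)[OF assms(1)] cyclic_pairs_D(1)[OF assms(2)] by auto
  have "poly_act A f' v = 0\<^sub>v (Polynomial.degree f)"
    using cyclic_pairs_annihilates[OF assms(2), of v] cyclic_pairs_D(2)[OF assms(1)] deg by simp
  then have "f dvd f'" using cyclic_pairs_kernel[OF assms(1,3)] by blast
  then show ?thesis using monic_dvd_same_degree_imp_eq deg assms by blast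
qed

lemma poly_act_cong:
  fixes f :: "'a :: {field, finite} poly"
  assumes pair: "(A, v) \<in> cyclic_pairs f" and monic: "Polynomial.lead_coeff f = 1"
  shows "poly_act A g v = poly_act A h v \<longleftrightarrow> f dvd g - h"
proof -
  note D = cyclic_pairs_D[OF pair]
  let ?n = "Polynomial.degree f"
  have car: "poly_act A g v \<in> carrier_vec ?n" "poly_act A h v \<in> carrier_vec ?n"
    using poly_act_carrier[OF D(1,2)] by simp_all
  have "poly_act A g v = poly_act A h v \<longleftrightarrow> poly_act A g v - poly_act A h v = 0\<^sub>v ?n"
  proof
    assume *: "poly_act A g v - poly_act A h v = 0\<^sub>v ?n"
    have "poly_act A g v = (poly_act A g v - poly_act A h v) + poly_act A h v"
      using car by (intro eq_vecI) auto
    then show "poly_act A g v = poly_act A h v" unfolding * using car by simp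
  qed (use car in simp)
  then show ?thesis
    using cyclic_pairs_kernel[OF pair monic] poly_act_diff[OF D(1,2)] by metis
qed

text \<open>
  With respect to the cyclic vector \<open>v\<close>, the vector $g(A)v$ is cyclic exactly when \<open>v\<close> can be
  recovered from it, that is, when \<open>g\<close> has an inverse modulo \<open>f\<close>.
\<close>

lemma card_cyclic_vecs:
  fixes f :: "'a :: {field, finite} poly"
  assumes pair: "(A, v) \<in> cyclic_pairs f" and monic: "Polynomial.lead_coeff f = 1"
  shows "card {w. (A, w) \<in> cyclic_pairs f} = poly_totient f"
proof -
  note D = cyclic_pairs_D[OF pair]
  let ?n = "Polynomial.degree f"
  let ?U = "{g \<in> polys_below ?n. unit_mod f g}"
  have f0: "f \<noteq> 0" using monic by auto
  have mod: "poly_act A (g mod f) v = poly_act A g v" for g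
    using poly_act_cong[OF pair monic] by (metis dvd_minus_mod dvd_minus_iff minus_diff_eq)
  have cyc: "(A, poly_act A g v) \<in> cyclic_pairs f \<longleftrightarrow> unit_mod f g" for g
  proof
    assume "(A, poly_act A g v) \<in> cyclic_pairs f"
    then obtain h where "poly_act A h (poly_act A g v) = v"
      using cyclic_vec_surj D(2) by blast
    then have "poly_act A (h * g) v = poly_act A 1 v"
      using poly_act_mult[OF D(1,2)] poly_act_1[OF D(1,2)] by simp
    then show "unit_mod f g" using poly_act_cong[OF pair monic] by (auto simp: unit_mod_def)
  next
    assume "unit_mod f g"
    then obtain h where "f dvd h * g - 1" by (auto simp: unit_mod_def)
    then have *: "poly_act A (h * g) v = v"
      using poly_act_cong[OF pair monic, of "h * g" 1] poly_act_1[OF D(1,2)] by simp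
    have car: "poly_act A g v \<in> carrier_vec ?n" using poly_act_carrier[OF D(1,2)] .
    have "\<exists>k. poly_act A k (poly_act A g v) = w" if w: "w \<in> carrier_vec ?n" for w
    proof -
      obtain k where k: "poly_act A k v = w" using cyclic_vec_surj[OF pair w] by blast
      have "poly_act A (k * h) (poly_act A g v) = poly_act A k (poly_act A h (poly_act A g v))"
        using poly_act_mult[OF D(1) car] .
      also have "\<dots> = w" using * k poly_act_mult[OF D(1,2), of h g] by simp
      finally show ?thesis by blast
    qed
    then have "cyclic_vec A (poly_act A g v)" using car D(1) by (auto simp: cyclic_vec_def)
    then show "(A, poly_act A g v) \<in> cyclic_pairs f"
      using D(1) cyclic_pairs_annihilates[OF pair car] by (simp add: cyclic_pairs_def)
  qed
  have "bij_betw (\<lambda>g. poly_act A g v) ?U {w. (A, w) \<in> cyclic_pairs f}"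
  proof (rule bij_betwI')
    fix g h assume gh: "g \<in> ?U" "h \<in> ?U"
    then have "f dvd g - h \<Longrightarrow> g = h" using polys_below_cong_imp_eq[of g f h] by blast
    then show "(poly_act A g v = poly_act A h v) = (g = h)"
      using poly_act_cong[OF pair monic, of g h] by blast
  next
    fix w assume w: "w \<in> {w. (A, w) \<in> cyclic_pairs f}"
    then obtain g where g: "poly_act A g v = w"
      using cyclic_vec_surj[OF pair] cyclic_pairs_D(2) by blast
    with w have "unit_mod f g" using cyc by blast
    then have "g mod f \<in> ?U" using mod_in_polys_below[OF f0] unit_mod_mod by blast
    then show "\<exists>g\<in>?U. w = poly_act A g v"
      using mod[of g] g by (intro bexI[of _ "g mod f"]) simp_all
  qed (use cyc in blast)
  then show ?thesis unfolding poly_totient_def by (rule bij_betw_same_card[symmetric])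
qed


section \<open>Cyclic pairs with a given annihilator and invertible matrices\<close>

text \<open>
  The matrix with columns $v, Av, \ldots, A^{n-1}v$.
\<close>

definition krylov_mat :: "'a :: field mat \<Rightarrow> nat \<Rightarrow> 'a vec \<Rightarrow> 'a mat" where
  "krylov_mat A n v = mat n n (\<lambda>(i, j). poly_act A (Polynomial.monom 1 j) v $ i)"

text \<open>
  Multiplication by $x$ on the residues modulo \<open>f\<close>, in the basis $1, x, \ldots, x^{n-1}$. Writing
  all columns uniformly as remainders avoids separating the last column from the others.
\<close>

definition companion :: "'a :: field poly \<Rightarrow> 'a mat" where
  "companion f = mat (Polynomial.degree f) (Polynomial.degree f)
     (\<lambda>(i, j). Polynomial.coeff (Polynomial.monom 1 (Suc j) mod f) i)"

lemma krylov_mat_carrier [simp]: "krylov_mat A n v \<in> carrier_mat n n"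
  by (simp add: krylov_mat_def)

lemma companion_carrier [simp]:
  "companion f \<in> carrier_mat (Polynomial.degree f) (Polynomial.degree f)"
  by (simp add: companion_def)

lemma krylov_mat_mult:
  assumes A: "A \<in> carrier_mat n n" and v: "v \<in> carrier_vec n" and g: "g \<in> polys_below n"
  shows "krylov_mat A n v *\<^sub>v coeff_vec n g = poly_act A g v"
proof (rule eq_vecI)
  show "dim_vec (krylov_mat A n v *\<^sub>v coeff_vec n g) = dim_vec (poly_act A g v)"
    using poly_act_carrier[OF A v, of g] by (simp add: krylov_mat_def)
next
  fix i assume "i < dim_vec (poly_act A g v)"
  then have i: "i < n" using poly_act_carrier[OF A v, of g] by simp
  then show "(krylov_mat A n v *\<^sub>v coeff_vec n g) $ i = poly_act A g v $ i"
    by (simp add: krylov_mat_def scalar_prod_def coeff_vec_def poly_act_expand[OF A v g i]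
        atLeast0LessThan mult.commute)
qed

lemma companion_mult_below:
  fixes f :: "'a :: field poly"
  assumes h: "h \<in> polys_below (Polynomial.degree f)"
  shows "companion f *\<^sub>v coeff_vec (Polynomial.degree f) h =
    coeff_vec (Polynomial.degree f) (pCons 0 h mod f)"
proof -
  let ?n = "Polynomial.degree f"
  have "pCons 0 h mod f =
      (\<Sum>j<m. Polynomial.smult (Polynomial.coeff h j) (Polynomial.monom 1 (Suc j) mod f))"
    if "h \<in> polys_below m" for m
  proof -
    have "pCons 0 h = (\<Sum>j<m. Polynomial.smult (Polynomial.coeff h j) (Polynomial.monom 1 (Suc j)))"
    proof (rule poly_eqI)
      fix i
      show "Polynomial.coeff (pCons 0 h) i = Polynomial.coeff
          (\<Sum>j<m. Polynomial.smult (Polynomial.coeff h j) (Polynomial.monom 1 (Suc j))) i"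
      proof (cases i)
        case 0
        then show ?thesis by (simp add: coeff_sum)
      next
        case (Suc k)
        then show ?thesis using that
          by (simp add: coeff_sum polys_below_def if_distrib cong: if_cong)
      qed
    qed
    moreover have "(\<Sum>j\<in>J. F j) mod f = (\<Sum>j\<in>J. F j mod f)" for F :: "nat \<Rightarrow> 'a poly" and J
      by (induction J rule: infinite_finite_induct) (simp_all add: poly_mod_add_left)
    ultimately show ?thesis by (simp add: mod_smult_left)
  qed
  from this[OF h] show ?thesis
    by (intro eq_vecI) (simp_all add: companion_def coeff_vec_def scalar_prod_def coeff_sum
        atLeast0LessThan mult.commute)
qed

text \<open>
  Acting on the residue \<open>1\<close>, a polynomial in the multiplication by $x$ yields its own residue. The
  degree has to be positive so that \<open>1\<close> is reduced modulo \<open>f\<close>.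
\<close>

lemma poly_act_companion:
  fixes f :: "'a :: field poly"
  assumes deg: "Polynomial.degree f > 0"
  shows "poly_act (companion f) g (coeff_vec (Polynomial.degree f) 1) =
    coeff_vec (Polynomial.degree f) (g mod f)"
proof (induction g)
  case 0
  then show ?case by (simp add: poly_act_0[OF companion_carrier])
next
  case (pCons a g)
  let ?n = "Polynomial.degree f"
  have f0: "f \<noteq> 0" using deg by auto
  have small: "[:a:] mod f = [:a:]" using deg by (intro mod_poly_less) simp
  have "pCons a g mod f = ([:a:] + pCons 0 g) mod f" by simp
  also have "\<dots> = [:a:] + pCons 0 g mod f" by (simp only: poly_mod_add_left small)
  also have "pCons 0 g mod f = pCons 0 (g mod f) mod f"
  proof -
    have "pCons 0 g = [:0, 1:] * g" "pCons 0 (g mod f) = [:0, 1:] * (g mod f)" by simp_all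
    then show ?thesis by (simp only: mod_mult_right_eq)
  qed
  finally have mod: "pCons a g mod f = [:a:] + pCons 0 (g mod f) mod f" .
  have "poly_act (companion f) (pCons a g) (coeff_vec ?n 1) =
      a \<cdot>\<^sub>v coeff_vec ?n 1 + companion f *\<^sub>v coeff_vec ?n (g mod f)"
    by (simp add: poly_act_pCons[OF companion_carrier] pCons.IH)
  also have "\<dots> = a \<cdot>\<^sub>v coeff_vec ?n 1 + coeff_vec ?n (pCons 0 (g mod f) mod f)"
    by (simp only: companion_mult_below[OF mod_in_polys_below[OF f0]])
  also have "\<dots> = coeff_vec ?n (pCons a g mod f)"
    unfolding mod by (intro eq_vecI) (auto simp: coeff_vec_def coeff_pCons split: nat.splits)
  finally show ?case .
qed

lemma poly_act_conjugate:
  fixes C P Q :: "'a :: field mat"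
  assumes C: "C \<in> carrier_mat n n" and P: "P \<in> carrier_mat n n" and Q: "Q \<in> carrier_mat n n"
    and QP: "Q * P = 1\<^sub>m n" and w: "w \<in> carrier_vec n"
  shows "poly_act (P * C * Q) g (P *\<^sub>v w) = P *\<^sub>v poly_act C g w"
proof (induction g)
  case 0
  have "P *\<^sub>v 0\<^sub>v n = 0\<^sub>v n" using P by (intro eq_vecI) (auto simp: scalar_prod_def)
  then show ?case using C P Q w by (simp add: poly_act_0[of _ n])
next
  case (pCons a g)
  have PCQ: "P * C * Q \<in> carrier_mat n n" using C P Q by auto
  have Pw: "P *\<^sub>v w \<in> carrier_vec n" using P w by auto
  have car: "poly_act C g w \<in> carrier_vec n" using poly_act_carrier[OF C w] .
  have "(P * C * Q) *\<^sub>v (P *\<^sub>v poly_act C g w) = (P * C) *\<^sub>v (Q *\<^sub>v (P *\<^sub>v poly_act C g w))"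
    using C P Q car by (intro assoc_mult_mat_vec[of _ n n _ n]) auto
  also have "Q *\<^sub>v (P *\<^sub>v poly_act C g w) = (Q * P) *\<^sub>v poly_act C g w"
    using P Q car by (intro assoc_mult_mat_vec[of _ n n _ n, symmetric]) auto
  also have "(P * C) *\<^sub>v ((Q * P) *\<^sub>v poly_act C g w) = P *\<^sub>v (C *\<^sub>v poly_act C g w)"
    unfolding QP using C P car by (simp add: assoc_mult_mat_vec[of _ n n _ n])
  finally have *: "(P * C * Q) *\<^sub>v (P *\<^sub>v poly_act C g w) = P *\<^sub>v (C *\<^sub>v poly_act C g w)" .
  have "poly_act (P * C * Q) (pCons a g) (P *\<^sub>v w) =
      a \<cdot>\<^sub>v (P *\<^sub>v w) + P *\<^sub>v (C *\<^sub>v poly_act C g w)"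
    by (simp add: poly_act_pCons[OF PCQ Pw] pCons.IH *)
  also have "\<dots> = P *\<^sub>v (a \<cdot>\<^sub>v w + C *\<^sub>v poly_act C g w)"
  proof -
    have "C *\<^sub>v poly_act C g w \<in> carrier_vec n" using C car by auto
    then show ?thesis
      using mult_add_distrib_mat_vec[OF P, of "a \<cdot>\<^sub>v w" "C *\<^sub>v poly_act C g w"]
        mult_mat_vec[OF P w, of a] w by simp
  qed
  finally show ?case by (simp add: poly_act_pCons[OF C w])
qed

lemma krylov_mat_invertible:
  fixes f :: "'a :: {field, finite} poly"
  assumes pair: "(A, v) \<in> cyclic_pairs f" and monic: "Polynomial.lead_coeff f = 1"
  shows "invertible_mat (krylov_mat A (Polynomial.degree f) v)"
proof -
  note D = cyclic_pairs_D[OF pair]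
  let ?n = "Polynomial.degree f"
  have "w = 0\<^sub>v ?n" if w: "w \<in> carrier_vec ?n" "krylov_mat A ?n v *\<^sub>v w = 0\<^sub>v ?n" for w
  proof -
    obtain g where g: "g \<in> polys_below ?n" "w = coeff_vec ?n g"
      using coeff_vec_surj[OF w(1)] by blast
    with w(2) have "poly_act A g v = 0\<^sub>v ?n" using krylov_mat_mult[OF D(1,2) g(1)] by simp
    then have "g = 0"
      using cyclic_pairs_kernel[OF pair monic] polys_below_dvd_imp_0[OF g(1)] by blast
    with g show ?thesis by simp
  qed
  then show ?thesis
    using inverse_mat_exists[OF krylov_mat_carrier] invertible_mat_iff[OF krylov_mat_carrier] by blast
qed

text \<open>
  The common matrix determines $g(A)v$ for all \<open>g\<close> of degree below \<open>n\<close>, hence for all \<open>g\<close> by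
  reduction modulo the common annihilator. The vector is the case \<open>g = 1\<close>, and the matrix maps
  $g(A)v$ to $(xg)(A)v$.
\<close>

lemma krylov_mat_inj:
  fixes f :: "'a :: {field, finite} poly"
  assumes p1: "(A, v) \<in> cyclic_pairs f" and p2: "(B, w) \<in> cyclic_pairs f"
    and monic: "Polynomial.lead_coeff f = 1"
    and eq: "krylov_mat A (Polynomial.degree f) v = krylov_mat B (Polynomial.degree f) w"
  shows "A = B \<and> v = w"
proof -
  note D = cyclic_pairs_D[OF p1] and E = cyclic_pairs_D[OF p2]
  let ?n = "Polynomial.degree f"
  have f0: "f \<noteq> 0" using monic by auto
  have same: "poly_act A g v = poly_act B g w" for g
  proof -
    have r: "f dvd g - g mod f" by (rule dvd_minus_mod)
    have "poly_act A g v = poly_act A (g mod f) v"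
      using r unfolding poly_act_cong[OF p1 monic] .
    also have "\<dots> = krylov_mat A ?n v *\<^sub>v coeff_vec ?n (g mod f)"
      using krylov_mat_mult[OF D(1,2) mod_in_polys_below[OF f0]] by simp
    also have "\<dots> = poly_act B (g mod f) w"
      unfolding eq using krylov_mat_mult[OF E(1,2) mod_in_polys_below[OF f0]] by simp
    also have "\<dots> = poly_act B g w"
      using r unfolding poly_act_cong[OF p2 monic, symmetric] by (rule sym)
    finally show ?thesis .
  qed
  have "v = w" using same[of 1] unfolding poly_act_1[OF D(1,2)] poly_act_1[OF E(1,2)] .
  moreover have "A = B"
  proof (rule mat_eqI_mult_vec[OF D(1) E(1)])
    fix x :: "'a vec" assume "x \<in> carrier_vec ?n"
    then obtain g where x: "poly_act A g v = x" using cyclic_vec_surj[OF p1] by blast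
    have "A *\<^sub>v x = poly_act A (pCons 0 g) v" using x poly_act_pCons_0(1)[OF D(1,2)] by simp
    also have "\<dots> = B *\<^sub>v x" using same[of "pCons 0 g"] same[of g] x poly_act_pCons_0(1)[OF E(1,2)]
      by simp
    finally show "A *\<^sub>v x = B *\<^sub>v x" .
  qed
  ultimately show ?thesis by blast
qed

text \<open>
  Every invertible matrix \<open>P\<close> arises from a cyclic pair: its columns are made the images of
  $1, x, \ldots, x^{n-1}$, and multiplication by $x$ is transported along \<open>P\<close>.
\<close>

lemma krylov_mat_conjugate_companion:
  fixes f :: "'a :: {field, finite} poly"
  assumes monic: "Polynomial.lead_coeff f = 1" and deg: "Polynomial.degree f > 0"
    and P: "P \<in> carrier_mat (Polynomial.degree f) (Polynomial.degree f)"
    and Q: "Q \<in> carrier_mat (Polynomial.degree f) (Polynomial.degree f)"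
    and PQ: "P * Q = 1\<^sub>m (Polynomial.degree f)" and QP: "Q * P = 1\<^sub>m (Polynomial.degree f)"
  defines "A \<equiv> P * companion f * Q" and "v \<equiv> P *\<^sub>v coeff_vec (Polynomial.degree f) 1"
  shows "(A, v) \<in> cyclic_pairs f" and "krylov_mat A (Polynomial.degree f) v = P"
proof -
  let ?n = "Polynomial.degree f"
  have f0: "f \<noteq> 0" using monic by auto
  have A: "A \<in> carrier_mat ?n ?n" unfolding A_def using P Q companion_carrier[of f] by auto
  have v: "v \<in> carrier_vec ?n" unfolding v_def using P by (auto intro: mult_mat_vec_carrier)
  have act: "poly_act A g v = P *\<^sub>v coeff_vec ?n (g mod f)" for g
    unfolding A_def v_def
    by (simp add: poly_act_conjugate[OF companion_carrier P Q QP] poly_act_companion[OF deg])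
  have "\<exists>g. poly_act A g v = w" if w: "w \<in> carrier_vec ?n" for w
  proof -
    have "Q *\<^sub>v w \<in> carrier_vec ?n" using Q w by auto
    then obtain g where g: "g \<in> polys_below ?n" "Q *\<^sub>v w = coeff_vec ?n g"
      using coeff_vec_surj by blast
    have "g mod f = g" using g(1) by (metis mod_poly_less mod_0 polys_below_iff)
    then have "poly_act A g v = P *\<^sub>v (Q *\<^sub>v w)" using act g by simp
    also have "\<dots> = (P * Q) *\<^sub>v w" using P Q w by (simp add: assoc_mult_mat_vec[of _ ?n ?n _ ?n])
    also have "\<dots> = w" using w by (simp add: PQ)
    finally show ?thesis by blast
  qed
  then have "cyclic_vec A v" using A v by (auto simp: cyclic_vec_def)
  moreover have "P *\<^sub>v 0\<^sub>v ?n = 0\<^sub>v ?n" using P by (intro eq_vecI) (auto simp: scalar_prod_def)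
  then have "poly_act A f v = 0\<^sub>v ?n" by (simp add: act)
  ultimately show "(A, v) \<in> cyclic_pairs f" using A by (simp add: cyclic_pairs_def)
  show "krylov_mat A ?n v = P"
  proof (rule mat_eqI_mult_vec[OF krylov_mat_carrier P])
    fix w :: "'a vec" assume "w \<in> carrier_vec ?n"
    then obtain g where g: "g \<in> polys_below ?n" "w = coeff_vec ?n g" using coeff_vec_surj by blast
    have "g mod f = g" using g(1) by (metis mod_poly_less mod_0 polys_below_iff)
    then show "krylov_mat A ?n v *\<^sub>v w = P *\<^sub>v w"
      using krylov_mat_mult[OF A v g(1)] act[of g] g(2) by simp
  qed
qed

lemma card_cyclic_pairs:
  fixes f :: "'a :: {field, finite} poly"
  assumes monic: "Polynomial.lead_coeff f = 1" and deg: "Polynomial.degree f > 0"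
  shows "card (cyclic_pairs f) = GL_order TYPE('a) (Polynomial.degree f)"
proof -
  let ?n = "Polynomial.degree f"
  let ?k = "\<lambda>(A, v). krylov_mat A ?n v"
  have "bij_betw ?k (cyclic_pairs f) {P :: 'a mat. P \<in> carrier_mat ?n ?n \<and> invertible_mat P}"
  proof (rule bij_betwI')
    fix x y assume xy: "x \<in> cyclic_pairs f" "y \<in> cyclic_pairs f"
    obtain A v B w where "x = (A, v)" "y = (B, w)" by (cases x, cases y)
    with xy krylov_mat_inj[OF _ _ monic, of A v B w] show "(?k x = ?k y) = (x = y)" by auto
  next
    fix x assume x: "x \<in> cyclic_pairs f"
    obtain A v where "x = (A, v)" by (cases x)
    with x show "?k x \<in> {P :: 'a mat. P \<in> carrier_mat ?n ?n \<and> invertible_mat P}"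
      using krylov_mat_invertible[OF _ monic, of A v] by simp
  next
    fix P :: "'a mat" assume "P \<in> {P. P \<in> carrier_mat ?n ?n \<and> invertible_mat P}"
    then have P: "P \<in> carrier_mat ?n ?n" and "invertible_mat P" by auto
    then obtain Q where Q: "Q \<in> carrier_mat ?n ?n" "P * Q = 1\<^sub>m ?n" "Q * P = 1\<^sub>m ?n"
      using invertible_mat_iff[OF P] by blast
    from krylov_mat_conjugate_companion[OF monic deg P Q]
    show "\<exists>x\<in>cyclic_pairs f. P = ?k x" by (metis (no_types, lifting) case_prod_conv)
  qed
  then show ?thesis unfolding GL_order_def by (rule bij_betw_same_card)
qed

lemma cyclic_pairs_similar_companion:
  fixes f :: "'a :: {field, finite} poly"
  assumes pair: "(A, v) \<in> cyclic_pairs f"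
    and monic: "Polynomial.lead_coeff f = 1" and deg: "Polynomial.degree f > 0"
  shows "similar_mat A (companion f)"
proof -
  let ?n = "Polynomial.degree f"
  let ?P = "krylov_mat A ?n v"
  obtain Q where Q: "Q \<in> carrier_mat ?n ?n" "?P * Q = 1\<^sub>m ?n" "Q * ?P = 1\<^sub>m ?n"
    using krylov_mat_invertible[OF pair monic] invertible_mat_iff[OF krylov_mat_carrier] by blast
  note K = krylov_mat_conjugate_companion[OF monic deg krylov_mat_carrier Q]
  have "A = ?P * companion f * Q"
    using krylov_mat_inj[OF pair K(1) monic] K(2) by simp
  then have "similar_mat_wit A (companion f) ?P Q"
    using Q cyclic_pairs_D(1)[OF pair] by (intro similar_mat_witI[of _ _ ?n]) auto
  then show ?thesis by (auto simp: similar_mat_def)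
qed

lemma finite_carrier_mat [simp]: "finite (carrier_mat n m :: 'a :: finite mat set)"
proof (rule finite_subset)
  show "carrier_mat n m \<subseteq> mat n m ` (({..<n} \<times> {..<m}) \<rightarrow>\<^sub>E (UNIV :: 'a set))"
  proof
    fix A :: "'a mat" assume "A \<in> carrier_mat n m"
    let ?F = "restrict (\<lambda>ij. A $$ ij) ({..<n} \<times> {..<m})"
    from \<open>A \<in> carrier_mat n m\<close> have "A = mat n m ?F" by (intro eq_matI) auto
    moreover have "?F \<in> ({..<n} \<times> {..<m}) \<rightarrow>\<^sub>E UNIV" by simp
    ultimately show "A \<in> mat n m ` (({..<n} \<times> {..<m}) \<rightarrow>\<^sub>E UNIV)"
      unfolding image_iff by (rule bexI)
  qed
  show "finite (mat n m ` (({..<n} \<times> {..<m}) \<rightarrow>\<^sub>E (UNIV :: 'a set)))"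
    by (intro finite_imageI finite_PiE) auto
qed

lemma GL_order_pos: "GL_order TYPE('a :: {field, finite}) n > 0"
proof -
  have "finite {A :: 'a mat. A \<in> carrier_mat n n \<and> invertible_mat A}"
    by (rule finite_subset[OF _ finite_carrier_mat[of n n]]) auto
  moreover have "invertible_mat (1\<^sub>m n :: 'a mat)"
    using invertible_mat_iff[of "1\<^sub>m n :: 'a mat" n] by auto
  then have "(1\<^sub>m n :: 'a mat) \<in> {A. A \<in> carrier_mat n n \<and> invertible_mat A}" by simp
  ultimately show ?thesis unfolding GL_order_def by (metis card_gt_0_iff empty_iff)
qed

text \<open>
  The double count: each matrix with annihilator \<open>f\<close> lies in as many cyclic pairs as there are
  units modulo \<open>f\<close>, and altogether there are as many pairs as invertible matrices.
\<close>

lemma card_cyclic_matrices: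
  fixes f :: "'a :: {field, finite} poly"
  assumes monic: "Polynomial.lead_coeff f = 1" and deg: "Polynomial.degree f > 0"
  shows "card {A. \<exists>v. (A, v) \<in> cyclic_pairs f} * poly_totient f =
    GL_order TYPE('a) (Polynomial.degree f)"
proof -
  let ?n = "Polynomial.degree f"
  let ?M = "{A. \<exists>v. (A, v) \<in> cyclic_pairs f}"
  have "finite ?M"
    by (rule finite_subset[OF _ finite_carrier_mat[of ?n ?n]]) (auto dest: cyclic_pairs_D(1))
  moreover have fin: "finite {v. (A, v) \<in> cyclic_pairs f}" for A
    by (rule finite_subset[OF _ finite_carrier_vec[of ?n]]) (auto dest: cyclic_pairs_D(2))
  ultimately have "card (Sigma ?M (\<lambda>A. {v. (A, v) \<in> cyclic_pairs f})) =
      (\<Sum>A\<in>?M. card {v. (A, v) \<in> cyclic_pairs f})"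
    by (intro card_SigmaI ballI)
  moreover have "Sigma ?M (\<lambda>A. {v. (A, v) \<in> cyclic_pairs f}) = cyclic_pairs f" by auto
  ultimately have "card (cyclic_pairs f) = (\<Sum>A\<in>?M. card {v. (A, v) \<in> cyclic_pairs f})"
    by (simp only:)
  also have "\<dots> = (\<Sum>A\<in>?M. poly_totient f)"
    by (rule sum.cong) (auto simp: card_cyclic_vecs[OF _ monic])
  finally show ?thesis using card_cyclic_pairs[OF monic deg] by simp
qed


section \<open>Separable matrices\<close>

lemma poly_act_map_mat:
  fixes A :: "'a :: field mat"
  assumes A: "A \<in> carrier_mat n n" and v: "v \<in> carrier_vec n"
  shows "poly_act (map_mat to_ac A) (map_poly to_ac g) (map_vec to_ac v) =
    map_vec to_ac (poly_act A g v)"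
proof (induction g)
  case 0
  have "map_mat to_ac A \<in> carrier_mat n n" "map_vec to_ac v \<in> carrier_vec n" using A v by auto
  then show ?case using A v by (simp add: poly_act_0[of _ n] to_ac.vec_hom_zero)
next
  case (pCons a g)
  have KA: "map_mat to_ac A \<in> carrier_mat n n" and Kv: "map_vec to_ac v \<in> carrier_vec n"
    using A v by auto
  have car: "poly_act A g v \<in> carrier_vec n" using poly_act_carrier[OF A v] .
  have "poly_act (map_mat to_ac A) (map_poly to_ac (pCons a g)) (map_vec to_ac v) =
      to_ac a \<cdot>\<^sub>v map_vec to_ac v + map_vec to_ac (A *\<^sub>v poly_act A g v)"
    using to_ac.mult_mat_vec_hom[OF A car] pCons.IH
    by (simp only: to_ac.map_poly_pCons_hom poly_act_pCons[OF KA Kv])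
  also have "\<dots> = map_vec to_ac (a \<cdot>\<^sub>v v + A *\<^sub>v poly_act A g v)"
    using A v car by (intro eq_vecI) auto
  finally show ?case by (simp only: poly_act_pCons[OF A v])
qed

lemma poly_act_diagonal:
  fixes D :: "'a :: field mat"
  assumes D: "D \<in> carrier_mat n n" and diag: "diagonal_mat D" and y: "y \<in> carrier_vec n"
  shows "poly_act D g y = vec n (\<lambda>i. poly g (D $$ (i, i)) * y $ i)"
proof (induction g)
  case 0
  then show ?case using D y by (intro eq_vecI) (simp_all add: poly_act_0[of _ n])
next
  case (pCons a g)
  have mult: "(D *\<^sub>v u) $ i = D $$ (i, i) * u $ i" if "i < n" "u \<in> carrier_vec n" for u i
  proof -
    have "(D *\<^sub>v u) $ i = (\<Sum>j = 0..<n. D $$ (i, j) * u $ j)"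
      using D that by (simp add: scalar_prod_def)
    also have "\<dots> = (\<Sum>j = 0..<n. if j = i then D $$ (i, i) * u $ i else 0)"
      by (rule sum.cong) (use D diag that in \<open>auto simp: diagonal_mat_def\<close>)
    finally show ?thesis using that by simp
  qed
  show ?case
    unfolding poly_act_pCons[OF D y] pCons.IH
    by (rule eq_vecI) (use D y mult in \<open>auto simp: algebra_simps\<close>)
qed

text \<open>
  If $f = g^2 h$, then \<open>f\<close> divides the square of \<open>r = g * h\<close>, so $r(A)^2$ annihilates \<open>v\<close>. In
  coordinates in which \<open>A\<close> is diagonal this says that $r(d)^2 y = 0$ for each eigenvalue $d$ with its
  coordinate $y$, which forces $r(d) y = 0$. Hence $r(A)$ itself annihilates \<open>v\<close>, although \<open>r\<close> has
  smaller degree than \<open>f\<close> when \<open>g\<close> is not constant.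
\<close>

lemma semisimple_cyclic_imp_squarefree:
  fixes f :: "'a :: {field, finite} poly"
  assumes pair: "(A, v) \<in> cyclic_pairs f" and monic: "Polynomial.lead_coeff f = 1"
    and semi: "semisimple_mat A"
  shows "squarefree f"
proof (rule squarefreeI, rule ccontr)
  fix g :: "'a poly" assume "g\<^sup>2 dvd f" and not_unit: "\<not> is_unit g"
  then obtain h where h: "f = g\<^sup>2 * h" by blast
  note C = cyclic_pairs_D[OF pair]
  let ?n = "Polynomial.degree f"
  define r where "r = g * h"
  have fgr: "f = g * r" and frr: "f dvd r * r"
    by (simp_all add: h r_def power2_eq_square mult_ac)
  have nz: "g \<noteq> 0" "r \<noteq> 0" using monic fgr by auto
  with not_unit have "Polynomial.degree g > 0" by (simp add: is_unit_iff_degree)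
  with nz have "Polynomial.degree r < Polynomial.degree f" by (simp add: fgr degree_mult_eq)
  then have not_dvd: "\<not> f dvd r" using nz dvd_imp_degree_le[of f r] by auto
  obtain D P Q where D: "diagonal_mat D" and wit: "similar_mat_wit (map_mat to_ac A) D P Q"
    using semi by (auto simp: semisimple_mat_def diagonalizable_mat_def similar_mat_def)
  have KA: "map_mat to_ac A \<in> carrier_mat ?n ?n" using C(1) by simp
  note W = similar_mat_witD2[OF KA wit]
  define y where "y = Q *\<^sub>v map_vec to_ac v"
  have y: "y \<in> carrier_vec ?n" using W(7) C(2) by (auto simp: y_def intro!: mult_mat_vec_carrier)
  have Py: "map_vec to_ac v = P *\<^sub>v y"
  proof -
    have "P *\<^sub>v y = (P * Q) *\<^sub>v map_vec to_ac v"
      unfolding y_def using W(6,7) C(2) by (intro assoc_mult_mat_vec[of _ ?n ?n _ ?n, symmetric]) auto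
    then show ?thesis using C(2) by (simp add: W(1))
  qed
  have act: "map_vec to_ac (poly_act A k v) =
      P *\<^sub>v vec ?n (\<lambda>i. poly (map_poly to_ac k) (D $$ (i, i)) * y $ i)" for k
    using poly_act_map_mat[OF C(1,2), of k] poly_act_conjugate[OF W(5,6,7,2) y, of "map_poly to_ac k"]
    unfolding Py W(3)[symmetric] poly_act_diagonal[OF W(5) D y] by simp
  have "poly_act A (r * r) v = 0\<^sub>v ?n" using cyclic_pairs_kernel[OF pair monic] frr by blast
  then have Pzero: "P *\<^sub>v vec ?n (\<lambda>i. poly (map_poly to_ac (r * r)) (D $$ (i, i)) * y $ i) = 0\<^sub>v ?n"
    using act[of "r * r"] by (simp add: to_ac.vec_hom_zero)
  have P_inj: "u = 0\<^sub>v ?n" if u: "u \<in> carrier_vec ?n" and "P *\<^sub>v u = 0\<^sub>v ?n" for u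
  proof -
    have "u = (Q * P) *\<^sub>v u" using u by (simp add: W(2))
    also have "\<dots> = Q *\<^sub>v (P *\<^sub>v u)" using W(6,7) u by (intro assoc_mult_mat_vec[of _ ?n ?n _ ?n])
    also have "\<dots> = 0\<^sub>v ?n" unfolding that(2) using W(7) by (intro eq_vecI) (auto simp: scalar_prod_def)
    finally show ?thesis .
  qed
  have zero: "vec ?n (\<lambda>i. poly (map_poly to_ac (r * r)) (D $$ (i, i)) * y $ i) = 0\<^sub>v ?n"
    by (rule P_inj) (use Pzero in simp_all)
  have "poly (map_poly to_ac (r * r)) (D $$ (i, i)) * y $ i = 0" if "i < ?n" for i
    using arg_cong[OF zero, of "\<lambda>u. u $ i"] that by (simp only: index_vec index_zero_vec)
  then have "poly (map_poly to_ac r) (D $$ (i, i)) * y $ i = 0" if "i < ?n" for i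
    using that by (simp add: to_ac_poly.hom_mult)
  then have "vec ?n (\<lambda>i. poly (map_poly to_ac r) (D $$ (i, i)) * y $ i) = 0\<^sub>v ?n"
    by (intro eq_vecI) simp_all
  then have "map_vec to_ac (poly_act A r v) = 0\<^sub>v ?n"
    unfolding act using W(6) by (intro eq_vecI) (auto simp: scalar_prod_def)
  then have "poly_act A r v = 0\<^sub>v ?n" by (simp add: to_ac.vec_hom_zero_iff)
  with not_dvd show False using cyclic_pairs_kernel[OF pair monic] by blast
qed

text \<open>
  The Vandermonde matrix of the roots evaluates a residue modulo \<open>f\<close> at the roots, and there
  multiplication by $x$ is multiplication by the root in each coordinate. It is invertible because a
  nonzero polynomial of degree below \<open>n\<close> cannot vanish at \<open>n\<close> points.
\<close>

lemma diagonalizable_companion: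
  fixes f :: "'a :: field poly"
  assumes roots: "card {x. poly f x = 0} = Polynomial.degree f" and deg: "Polynomial.degree f > 0"
  shows "diagonalizable_mat (companion f)"
proof -
  let ?n = "Polynomial.degree f"
  have f0: "f \<noteq> 0" using deg by auto
  obtain xs where xs: "set xs = {x. poly f x = 0}" "distinct xs"
    using finite_distinct_list[OF poly_roots_finite[OF f0]] by blast
  then have len: "length xs = ?n" using roots by (metis distinct_card)
  define V where "V = mat ?n ?n (\<lambda>(i, j). xs ! i ^ j)"
  define D where "D = mat ?n ?n (\<lambda>(i, j). if i = j then xs ! i else 0)"
  have V: "V \<in> carrier_mat ?n ?n" and D: "D \<in> carrier_mat ?n ?n" by (simp_all add: V_def D_def)
  have diag: "diagonal_mat D" by (auto simp: diagonal_mat_def D_def)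
  have Vg: "V *\<^sub>v coeff_vec ?n g = vec ?n (\<lambda>i. poly g (xs ! i))" if g: "g \<in> polys_below ?n" for g
  proof (rule eq_vecI)
    fix i assume "i < dim_vec (vec ?n (\<lambda>i. poly g (xs ! i)))"
    then have i: "i < ?n" by simp
    have "poly g (xs ! i) = (\<Sum>j<?n. Polynomial.coeff g j * (xs ! i) ^ j)"
    proof -
      have "(\<Sum>j\<le>Polynomial.degree g. Polynomial.coeff g j * (xs ! i) ^ j) =
          (\<Sum>j<?n. Polynomial.coeff g j * (xs ! i) ^ j)"
        by (rule sum.mono_neutral_left)
           (use g deg in \<open>auto simp: polys_below_iff intro: coeff_eq_0\<close>)
      then show ?thesis by (simp add: poly_altdef)
    qed
    then show "(V *\<^sub>v coeff_vec ?n g) $ i = vec ?n (\<lambda>i. poly g (xs ! i)) $ i"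
      using i by (simp add: V_def scalar_prod_def coeff_vec_def atLeast0LessThan mult.commute)
  qed (use V in simp)
  have "w = 0\<^sub>v ?n" if w: "w \<in> carrier_vec ?n" "V *\<^sub>v w = 0\<^sub>v ?n" for w
  proof -
    obtain g where g: "g \<in> polys_below ?n" "w = coeff_vec ?n g" using coeff_vec_surj[OF w(1)] by blast
    have root: "poly g (xs ! i) = 0" if "i < ?n" for i
      using w(2) Vg[OF g(1)] that unfolding g(2) by (metis index_vec index_zero_vec(1))
    have "g = 0"
    proof (rule ccontr)
      assume "g \<noteq> 0"
      have "set xs \<subseteq> {x. poly g x = 0}" using root len by (auto simp: in_set_conv_nth)
      then have "card (set xs) \<le> card {x. poly g x = 0}"
        using poly_roots_finite[OF \<open>g \<noteq> 0\<close>] by (rule card_mono[rotated])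
      also have "\<dots> \<le> Polynomial.degree g" using \<open>g \<noteq> 0\<close> by (rule card_poly_roots_bound)
      also have "\<dots> < ?n" using g(1) \<open>g \<noteq> 0\<close> by (simp add: polys_below_iff)
      finally show False using xs(1) roots by simp
    qed
    with g(2) show ?thesis by simp
  qed
  then obtain U where U: "U \<in> carrier_mat ?n ?n" "V * U = 1\<^sub>m ?n" "U * V = 1\<^sub>m ?n"
    using inverse_mat_exists[OF V] by blast
  have C: "companion f \<in> carrier_mat ?n ?n" by simp
  have VC: "V * companion f = D * V"
  proof (rule mat_eqI_mult_vec[of _ ?n])
    fix w :: "'a vec" assume "w \<in> carrier_vec ?n"
    then obtain g where g: "g \<in> polys_below ?n" "w = coeff_vec ?n g" using coeff_vec_surj by blast
    have w: "w \<in> carrier_vec ?n" by fact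
    have "(V * companion f) *\<^sub>v w = V *\<^sub>v (companion f *\<^sub>v w)"
      using V C w by (intro assoc_mult_mat_vec[of _ ?n ?n _ ?n])
    also have "\<dots> = vec ?n (\<lambda>i. poly (pCons 0 g mod f) (xs ! i))"
      unfolding g(2) companion_mult_below[OF g(1)] by (rule Vg[OF mod_in_polys_below[OF f0]])
    also have "\<dots> = vec ?n (\<lambda>i. xs ! i * poly g (xs ! i))"
    proof (rule eq_vecI)
      fix i assume "i < dim_vec (vec ?n (\<lambda>i. xs ! i * poly g (xs ! i)))"
      then have i: "i < ?n" by simp
      then have "poly f (xs ! i) = 0" using xs(1) len nth_mem[of i xs] by auto
      then have "poly (pCons 0 g mod f) (xs ! i) = poly (pCons 0 g) (xs ! i)"
        by (rule poly_mod)
      then show "vec ?n (\<lambda>i. poly (pCons 0 g mod f) (xs ! i)) $ i =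
          vec ?n (\<lambda>i. xs ! i * poly g (xs ! i)) $ i" using i by simp
    qed simp
    also have "\<dots> = D *\<^sub>v (V *\<^sub>v w)"
    proof (rule eq_vecI)
      fix i assume "i < dim_vec (D *\<^sub>v (V *\<^sub>v w))"
      then have i: "i < ?n" using D by simp
      have "(\<Sum>j<?n. (if i = j then xs ! i else 0) * poly g (xs ! j)) =
          (\<Sum>j<?n. if i = j then xs ! i * poly g (xs ! i) else 0)"
        by (rule sum.cong) auto
      then show "vec ?n (\<lambda>i. xs ! i * poly g (xs ! i)) $ i = (D *\<^sub>v (V *\<^sub>v w)) $ i"
        unfolding g(2) Vg[OF g(1)] using i
        by (simp add: D_def scalar_prod_def atLeast0LessThan)
    qed (use D in simp)
    also have "\<dots> = (D * V) *\<^sub>v w"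
      using V D w by (intro assoc_mult_mat_vec[of _ ?n ?n _ ?n, symmetric])
    finally show "(V * companion f) *\<^sub>v w = (D * V) *\<^sub>v w" .
  qed (use V D C in auto)
  have "companion f = (U * V) * companion f" unfolding U(3) by (rule left_mult_one_mat[OF C, symmetric])
  also have "\<dots> = U * (V * companion f)" using U(1) V C by (rule assoc_mult_mat)
  also have "\<dots> = U * D * V" unfolding VC using U(1) D V by (rule assoc_mult_mat[symmetric])
  finally have "similar_mat_wit (companion f) D U V"
    using U V D C by (intro similar_mat_witI[of _ _ ?n])
  with diag show ?thesis by (auto simp: diagonalizable_mat_def similar_mat_def)
qed

lemma map_mat_companion:
  "map_mat to_ac (companion f) = companion (map_poly to_ac f)"
  by (intro eq_matI)
     (simp_all add: companion_def to_ac.map_poly_mod flip: to_ac.coeff_map_poly_hom)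

lemma squarefree_cyclic_imp_semisimple:
  fixes f :: "'a :: {field, finite} poly"
  assumes pair: "(A, v) \<in> cyclic_pairs f" and monic: "Polynomial.lead_coeff f = 1"
    and deg: "Polynomial.degree f > 0" and sqf: "squarefree f"
  shows "semisimple_mat A"
proof -
  let ?n = "Polynomial.degree f"
  let ?K = "map_mat to_ac :: 'a mat \<Rightarrow> 'a alg_closure mat"
  obtain P Q where wit: "similar_mat_wit A (companion f) P Q"
    using cyclic_pairs_similar_companion[OF pair monic deg] by (auto simp: similar_mat_def)
  note W = similar_mat_witD2[OF cyclic_pairs_D(1)[OF pair] wit]
  have "similar_mat_wit (?K A) (?K (companion f)) (?K P) (?K Q)"
  proof (rule similar_mat_witI[of _ _ ?n])
    show "?K P * ?K Q = 1\<^sub>m ?n" "?K Q * ?K P = 1\<^sub>m ?n"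
      using to_ac.mat_hom_mult[OF W(6,7)] to_ac.mat_hom_mult[OF W(7,6)] W(1,2)
      by (simp_all add: to_ac.mat_hom_one)
    have "?K A = ?K (P * companion f) * ?K Q"
      unfolding W(3) using W(5,6,7) by (intro to_ac.mat_hom_mult[of _ ?n ?n]) auto
    then show "?K A = ?K P * ?K (companion f) * ?K Q"
      using to_ac.mat_hom_mult[OF W(6,5)] by simp
  qed (use W in auto)
  then have sim: "similar_mat (?K A) (?K (companion f))" by (auto simp: similar_mat_def)
  have "card {x. poly (map_poly to_ac f) x = 0} = Polynomial.degree (map_poly to_ac f)"
    using card_roots_squarefree[OF monic sqf] by simp
  then have "diagonalizable_mat (?K (companion f))"
    unfolding map_mat_companion using deg by (intro diagonalizable_companion) simp_all
  with sim show ?thesis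
    unfolding semisimple_mat_def diagonalizable_mat_def using similar_mat_trans by blast
qed

lemma separable_mat_iff:
  fixes A :: "'a :: {field, finite} mat"
  assumes A: "A \<in> carrier_mat n n" and n: "n > 0"
  shows "separable_mat A \<longleftrightarrow> (\<exists>f \<in> monic_squarefree n. \<exists>v. (A, v) \<in> cyclic_pairs f)"
proof
  assume sep: "separable_mat A"
  then obtain v where v: "cyclic_vec A v"
    using cyclic_mat_iff_cyclic_vec[OF A] by (auto simp: separable_mat_def)
  from annihilator_exists[OF A v] obtain f where f: "Polynomial.lead_coeff f = 1"
    "Polynomial.degree f = n" and "\<forall>g. poly_act A g v = 0\<^sub>v n \<longleftrightarrow> f dvd g" by blast
  then have "poly_act A f v = 0\<^sub>v n" by simp
  with f(2) have "(A, v) \<in> cyclic_pairs f" using A v by (simp add: cyclic_pairs_def)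
  moreover from this have "squarefree f"
    using semisimple_cyclic_imp_squarefree f(1) sep by (auto simp: separable_mat_def)
  ultimately show "\<exists>f \<in> monic_squarefree n. \<exists>v. (A, v) \<in> cyclic_pairs f"
    using f(1,2) unfolding monic_squarefree_def by blast
next
  assume "\<exists>f \<in> monic_squarefree n. \<exists>v. (A, v) \<in> cyclic_pairs f"
  then obtain f v where f: "Polynomial.lead_coeff f = 1" "squarefree f" "Polynomial.degree f = n"
    and pair: "(A, v) \<in> cyclic_pairs f" unfolding monic_squarefree_def by blast
  have "cyclic_mat A"
    using cyclic_mat_iff_cyclic_vec[OF A] cyclic_pairs_D(3)[OF pair] by blast
  moreover have "semisimple_mat A"
    using squarefree_cyclic_imp_semisimple[OF pair f(1) _ f(2)] f(3) n by simp
  ultimately show "separable_mat A" by (simp add: separable_mat_def)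
qed

lemma num_separable_eq_sum:
  assumes n: "n > 0"
  shows "num_separable TYPE('a :: {field, finite}) n =
    (\<Sum>f \<in> (monic_squarefree n :: 'a poly set). card {A. \<exists>v. (A, v) \<in> cyclic_pairs f})"
proof -
  let ?M = "\<lambda>f :: 'a poly. {A. \<exists>v. (A, v) \<in> cyclic_pairs f}"
  have "{A :: 'a mat. A \<in> carrier_mat n n \<and> separable_mat A} = (\<Union>f \<in> monic_squarefree n. ?M f)"
    (is "?L = ?R")
  proof (intro equalityI subsetI)
    fix A assume "A \<in> ?L"
    then show "A \<in> ?R" using separable_mat_iff[OF _ n, of A] by blast
  next
    fix A assume "A \<in> ?R"
    then obtain f v where f: "f \<in> monic_squarefree n" "(A, v) \<in> cyclic_pairs f" by blast
    then have "A \<in> carrier_mat n n"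
      using cyclic_pairs_D(1)[OF f(2)] by (auto simp: monic_squarefree_def)
    with f show "A \<in> ?L" using separable_mat_iff[OF _ n, of A] by blast
  qed
  moreover have "card (\<Union>f \<in> monic_squarefree n. ?M f) = (\<Sum>f \<in> monic_squarefree n. card (?M f))"
  proof (rule card_UN_disjoint)
    show "finite (monic_squarefree n :: 'a poly set)"
      by (rule finite_subset[OF _ finite_polys_below[of "Suc n"]])
         (auto simp: monic_squarefree_def polys_below_iff)
    show "\<forall>f \<in> monic_squarefree n. finite (?M f)"
    proof
      fix f :: "'a poly"
      show "finite (?M f)"
        by (rule finite_subset[OF _ finite_carrier_mat[of "Polynomial.degree f" "Polynomial.degree f"]])
           (auto dest: cyclic_pairs_D(1))
    qed
    show "\<forall>f \<in> monic_squarefree n. \<forall>g \<in> monic_squarefree n. f \<noteq> g \<longrightarrow> ?M f \<inter> ?M g = {}"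
      using cyclic_pairs_unique unfolding monic_squarefree_def by blast
  qed
  ultimately show ?thesis by (simp add: num_separable_def)
qed

text \<open>
  Each squarefree \<open>f\<close> contributes $\gamma_n / \varphi(f)$ matrices by the double count.
\<close>

lemma num_separable_over_GL_order:
  assumes n: "n > 0"
  shows "of_nat (num_separable TYPE('a :: {field, finite}) n) / of_nat (GL_order TYPE('a) n) =
    fps_nth (squarefree_series TYPE('a)) n"
proof -
  let ?\<gamma> = "of_nat (GL_order TYPE('a) n) :: rat"
  have q: "CARD('a) ^ k \<ge> 1" for k by simp
  have pos: "?\<gamma> > 0" using GL_order_pos by simp
  have each: "of_nat (card {A. \<exists>v. (A, v) \<in> cyclic_pairs f}) / ?\<gamma> = 1 / of_nat (poly_totient f)"
    if "f \<in> monic_squarefree n" for f :: "'a poly"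
  proof -
    have f: "Polynomial.lead_coeff f = 1" "Polynomial.degree f = n"
      using that unfolding monic_squarefree_def by blast+
    have card: "card {A. \<exists>v. (A, v) \<in> cyclic_pairs f} * poly_totient f = GL_order TYPE('a) n"
      using card_cyclic_matrices[OF f(1)] f(2) n by simp
    then have "poly_totient f \<noteq> 0"
      using GL_order_pos[of n, where ?'a = 'a] by (metis mult_0_right less_irrefl)
    moreover have "of_nat (card {A. \<exists>v. (A, v) \<in> cyclic_pairs f}) * of_nat (poly_totient f) = ?\<gamma>"
      unfolding card[symmetric] by simp
    ultimately show ?thesis using pos by (simp add: field_simps)
  qed
  have "of_nat (num_separable TYPE('a) n) / ?\<gamma> =
      (\<Sum>f \<in> (monic_squarefree n :: 'a poly set). 1 / of_nat (poly_totient f))"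
    by (simp add: num_separable_eq_sum[OF n] sum_divide_distrib each)
  also have "\<dots> = (\<Sum>S \<in> (irreducible_sets n :: 'a poly set set). 1 / of_nat (poly_totient (\<Prod>S)))"
    by (rule sum.reindex_bij_betw[OF bij_betw_irreducible_sets, symmetric])
  also have "\<dots> = (\<Sum>S \<in> (irreducible_sets n :: 'a poly set set).
      \<Prod>p\<in>S. 1 / (of_nat CARD('a) ^ Polynomial.degree p - 1))"
  proof (rule sum.cong[OF refl])
    fix S :: "'a poly set" assume "S \<in> irreducible_sets n"
    then have "poly_totient (\<Prod>S) = (\<Prod>p\<in>S. CARD('a) ^ Polynomial.degree p - 1)"
      by (intro poly_totient_prod) (auto simp: irreducible_sets_def)
    then show "1 / of_nat (poly_totient (\<Prod>S)) =
        (\<Prod>p\<in>S. 1 / (of_nat CARD('a) ^ Polynomial.degree p - 1) :: rat)"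
      by (simp add: of_nat_diff q prod_dividef)
  qed
  finally show ?thesis by (simp add: squarefree_series_def)
qed

theorem theorem19:
  fixes q :: nat and a \<gamma> \<nu> :: "nat \<Rightarrow> nat" and f g :: "nat \<Rightarrow> rat fps"
  assumes "q = CARD('a :: {field, finite})"
  defines "a \<equiv> num_separable TYPE('a)"
    and "\<gamma> \<equiv> GL_order TYPE('a)"
    and "\<nu> \<equiv> num_monic_irreducible TYPE('a)"
  defines "f \<equiv> (\<lambda>d. (1 + fps_X ^ d / fps_const (of_nat q ^ d - 1)) ^ \<nu> d)"
    and "g \<equiv> (\<lambda>d. (1 + fps_X ^ d * (1 - fps_X ^ d) /
                       fps_const (of_nat q ^ d * (of_nat q ^ d - 1))) ^ \<nu> d)"
  shows "convergent_prod (\<lambda>d. f (Suc d)) \<and>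
         1 + Abs_fps (\<lambda>n. if n = 0 then 0 else of_nat (a n) / of_nat (\<gamma> n)) =
           (\<Prod>d. f (Suc d)) \<and>
         convergent_prod (\<lambda>d. g (Suc d)) \<and>
         1 + Abs_fps (\<lambda>n. if n = 0 then 0 else of_nat (a n) / of_nat (\<gamma> n)) =
           1 / (1 - fps_X) * (\<Prod>d. g (Suc d))"
proof -
  let ?L = "squarefree_series TYPE('a)"
  have f: "f d = (1 + fps_X ^ d / fps_const (of_nat CARD('a) ^ d - 1)) ^
      num_monic_irreducible TYPE('a) d" for d
    by (simp only: f_def \<nu>_def assms(1))
  have g: "g d = (1 + fps_X ^ d * (1 - fps_X ^ d) /
      fps_const (of_nat CARD('a) ^ d * (of_nat CARD('a) ^ d - 1))) ^
      num_monic_irreducible TYPE('a) d" for d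
    by (simp only: g_def \<nu>_def assms(1))
  have "1 + Abs_fps (\<lambda>n. if n = 0 then 0 else of_nat (a n) / of_nat (\<gamma> n)) = ?L"
  proof (rule fps_ext)
    fix n
    show "fps_nth (1 + Abs_fps (\<lambda>n. if n = 0 then 0 else of_nat (a n) / of_nat (\<gamma> n))) n = fps_nth ?L n"
      using num_separable_over_GL_order[of n, where ?'a = 'a] nth_squarefree_series_0[where ?'a = 'a]
      by (cases "n = 0") (simp_all add: a_def \<gamma>_def)
  qed
  with squarefree_series_eq_products[OF f g] show ?thesis by metis
qed

end
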